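(* For $\delta>0$ consider, in the plane $(g,G)$ with $g$ taken mod $2\pi$ ($\mathbb T=\mathbb R/2\pi\mathbb Z$) and $-1\le G\le 1$, the function $$F_\delta(g,G)=G^2+\delta\sqrt{1-G^2}\,\cos g$$ and its level sets $F_\delta(g,G)=c$. **Equilibria.** For $\delta\in(0,2)$, $F_\delta$ has a minimum, a saddle and a maximum, respectively at $$P_-=(\pi,0),\qquad P_0=(0,0),\qquad P_+=\Big(0,\sqrt{1-\tfrac{\delta^2}{4}}\Big),$$ where it takes the values $-\delta$, $\delta$, $1+\frac{\delta^2}{4}$ respectively; the level sets are non-empty only for $c\in[-\delta,1+\frac{\delta^2}{4}]$. For $\delta>2$ the saddle and the level set through it do not exist, $P_-=(\pi,0)$ is still a minimum, while $P_+=(0,0)$ becomes a maximum; the admissible values are $c\in[-\delta,\delta]$. **The manifolds $\mathcal S_0$, $\mathcal S_1$.** Let $\mathcal S_0$ be the level set through the saddle $P_0$ (level $c=\delta$) and $\mathcal S_1$ the level set with $c=1$. Their equations are $$\mathcal S_0(\delta)=\Big\{G^2+\delta\sqrt{1-G^2}\cos g=\delta\Big\},\qquad \mathcal S_1(\delta)=\big\{G=\pm1\big\}\cup\Big\{G=\pm\sqrt{1-\delta^2\cos^2 g}\Big\}.$$ The two branches of $\mathcal S_1$ ("horizontal" and "vertical" respectively) glue smoothly at $(\pm\frac{\pi}{2},1)$. When $0\le\delta\le1$ the vertical branch is defined for all $g\in\mathbb T$; when $\delta>1$ its domain in $g$ is made of two disjoint neighborhoods of $\pm\frac\pi2$. $\mathcal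 S_1$ still exists for $\delta>2$, and as $\delta\to+\infty$ its vertical branch gets closer and closer to the portion of the straight lines $g=\pm\frac\pi2$ in the strip $-1\le G\le1$. **Phase portrait.** 1) $0<\delta\le1$: - $-\delta\le c<\delta$: the level curves encircle the minimum $P_-$; - $c=\delta$ is the manifold $\mathcal S_0$; - $\delta<c<1$: the level curves are defined for all $g\in\mathbb T$; - $c=1$ is the manifold $\mathcal S_1$; - $1<c\le1+\frac{\delta^2}{4}$: the level curves encircle the maximum $P_+$. With $\delta=1$ the second, third and fourth items, and hence the two manifolds $\mathcal S_0$ and $\mathcal S_1$, merge. With $\delta=0$ the first item merges with the second and the fifth with the fourth; $\mathcal S_0$ is contracted to the $g$-axis, $\mathcal S_1$ is contracted to the axis $G=1$, and the level curves are straight lines parallel to the $g$-axis, i.e. the level sets reduce to $G=\text{const}$. 2) $1<\delta\le2$: - $-\delta\le c<1$: the level curves encircle the minimum $P_-$; - $c=1$ is the manifold $\mathcal S_1$; - $1<c<\delta$: the level curves encircle the saddle $P_0$; - $c=\delta$ is the manifold $\mathcal S_0$; - $\delta<c\le1+\frac{\delta^2}{4}$: the level curves encircle the maximum $P_+$. When $\delta=2$ the last two items merge, and the manifold $\mathcal S_0$ with the librations inside is contracted to the point $P_0$. 3) $\delta>2$: - $-\delta\le c<1$: the level curves encircle the minimum $P_-$; - $c=1$ corresponds to the manifold $\mathcal S_1$; - $1<c<\delta$: the level curves encircle the maximum $P_+=(0,0)$.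
   Context: $F_\delta$ is even in $G$, so the level sets are symmetric under $G\mapsto-G$; in particular, for $\delta\in(0,2)$, the level $c=1+\frac{\delta^2}{4}$ reduces to $\big(0,\pm\sqrt{1-\delta^2/4}\big)$. Origin: $F_\delta$ is the function $\mathrm E_0=\|\mathbf M\|^2-\mathbf x'\cdot\mathbf L$ ($\mathbf M$ the angular momentum and $\mathbf L$ the eccentricity vector of the Kepler ellipse of the moving particle, $\mathbf x'$ the position of the second centre, the first one being at the origin) in the planar case, divided by $\Lambda^2$. Here $G$ is the angular momentum divided by the Delaunay action $\Lambda$, $g$ is an angle giving the direction of the perihelion, and $\delta=\|\mathbf x'\|/a$ with $a$ the semi-major axis.
   Formalization: The vertical branch of S_1 is restricted to cos g >= 0, since the printed equation fails elsewhere (δ=1/2, g=π, G=√3/2 gives F=1/2); its domain claims are proved for the printed curve, with the true domain on S_1 added. "Glue smoothly" means C^1, as C^2 fails. *)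

theory Defs
  imports "HOL-Analysis.Analysis"
begin

text \<open>
  The cylinder \<open>\<real>/2\<pi>\<int> \<times> [-1,1]\<close> is represented by its universal cover, the strip
  \<open>\<real> \<times> [-1,1]\<close> of pairs \<open>(g,G)\<close>; a subset of the cylinder is a \<open>2\<pi>\<close>-periodic subset of the strip.
\<close>

definition strip :: "(real \<times> real) set" where
  "strip = UNIV \<times> {-1..1}"

definition lift :: "(real \<times> real) set \<Rightarrow> (real \<times> real) set" where
  "lift S = {(g + 2 * pi * of_int k, G) | g G k. (g, G) \<in> S}"

definition F :: "real \<Rightarrow> real \<times> real \<Rightarrow> real" where
  "F \<delta> = (\<lambda>(g, G). G\<^sup>2 + \<delta> * sqrt (1 - G\<^sup>2) * cos g)"

definition level :: "real \<Rightarrow> real \<Rightarrow> (real \<times> real) set" where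
  "level \<delta> c = {p \<in> strip. F \<delta> p = c}"

definition P_minus :: "real \<times> real" where
  "P_minus = (pi, 0)"

definition P_zero :: "real \<times> real" where
  "P_zero = (0, 0)"

text \<open>
  For \<open>\<delta> > 2\<close> the square root is no longer meaningful and the maximum sits at the origin.
  \<open>F\<close> is even in \<open>G\<close>, so that the mirror image of \<open>P_plus\<close> is also a maximum.
\<close>

definition P_plus :: "real \<Rightarrow> real \<times> real" where
  "P_plus \<delta> = (if \<delta> \<le> 2 then (0, sqrt (1 - \<delta>\<^sup>2 / 4)) else (0, 0))"

definition mirror :: "real \<times> real \<Rightarrow> real \<times> real" where
  "mirror = (\<lambda>(g, G). (g, - G))"

definition equilibrium :: "(real \<times> real \<Rightarrow> real) \<Rightarrow> real \<times> real \<Rightarrow> bool" where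
  "equilibrium f p \<longleftrightarrow> p \<in> strip \<and> (f has_derivative (\<lambda>_. 0)) (at p within strip)"

text \<open>
  A saddle is an interior critical point whose Hessian \<open>H\<close> is indefinite
  (which in dimension two entails that it is nondegenerate).
\<close>

definition saddle :: "(real \<times> real \<Rightarrow> real) \<Rightarrow> real \<times> real \<Rightarrow> bool" where
  "saddle f p \<longleftrightarrow> p \<in> interior strip \<and>
     (\<exists>f' H. (\<forall>\<^sub>F x in nhds p. (f has_derivative f' x) (at x)) \<and>
             f' p = (\<lambda>_. 0) \<and>
             (\<forall>v. ((\<lambda>x. f' x v) has_derivative (\<lambda>u. H u v)) (at p)) \<and>
             (\<exists>u. H u u > 0) \<and> (\<exists>v. H v v < 0))"

definition S0 :: "real \<Rightarrow> (real \<times> real) set" where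
  "S0 \<delta> = level \<delta> (F \<delta> P_zero)"

definition S1 :: "real \<Rightarrow> (real \<times> real) set" where
  "S1 \<delta> = level \<delta> 1"

definition horizontal_branch :: "(real \<times> real) set" where
  "horizontal_branch = {(g, G). G = 1 \<or> G = -1}"

definition vert :: "real \<Rightarrow> real \<Rightarrow> real" where
  "vert \<delta> g = sqrt (1 - \<delta>\<^sup>2 * (cos g)\<^sup>2)"

definition vertical_curve :: "real \<Rightarrow> (real \<times> real) set" where
  "vertical_curve \<delta> = {(g, G). 0 \<le> 1 - \<delta>\<^sup>2 * (cos g)\<^sup>2 \<and> (G = vert \<delta> g \<or> G = - vert \<delta> g)}"

text \<open>
  On the level \<open>F = 1\<close> with \<open>\<bar>G\<bar> < 1\<close> one has \<open>sqrt (1 - G\<^sup>2) = \<delta> * cos g\<close>. Squaring this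
  equation gives \<open>vertical_curve\<close>, but loses the sign condition \<open>0 \<le> cos g\<close>: only the
  following part of the curve lies on the level set.
\<close>

definition vertical_branch :: "real \<Rightarrow> (real \<times> real) set" where
  "vertical_branch \<delta> = vertical_curve \<delta> \<inter> {(g, G). 0 \<le> cos g}"

definition C1_glued_at :: "(real \<Rightarrow> real) \<Rightarrow> (real \<Rightarrow> real) \<Rightarrow> real \<Rightarrow> bool" where
  "C1_glued_at h k x \<longleftrightarrow> h x = k x \<and>
     (\<exists>\<epsilon>>0. (\<lambda>y. if y \<le> x then h y else k y) C1_differentiable_on {x - \<epsilon><..<x + \<epsilon>} \<and>
            (\<lambda>y. if y \<le> x then k y else h y) C1_differentiable_on {x - \<epsilon><..<x + \<epsilon>})"

text \<open>Convergence to \<open>0\<close> of the Hausdorff distance between \<open>S t\<close> and \<open>T\<close>.\<close>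

definition hausdorff_tendsto ::
    "('b \<Rightarrow> 'a::metric_space set) \<Rightarrow> 'a set \<Rightarrow> 'b filter \<Rightarrow> bool" where
  "hausdorff_tendsto S T \<F> \<longleftrightarrow>
     (\<forall>\<epsilon>>0. \<forall>\<^sub>F t in \<F>. (\<forall>x\<in>S t. \<exists>y\<in>T. dist x y < \<epsilon>) \<and> (\<forall>y\<in>T. \<exists>x\<in>S t. dist x y < \<epsilon>))"

definition simple_closed_curve :: "(real \<times> real) set \<Rightarrow> bool" where
  "simple_closed_curve C \<longleftrightarrow>
     (\<exists>\<gamma>. simple_path \<gamma> \<and> pathfinish \<gamma> = pathstart \<gamma> \<and> path_image \<gamma> = C)"

text \<open>
  \<open>L\<close> consists, modulo \<open>2\<pi>\<close>, of pairwise disjoint simple closed curves \<open>C P\<close>, one for each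
  \<open>P \<in> Ps\<close>, such that \<open>C P\<close> has \<open>P\<close> and no other point of \<open>Ps\<close> in its inside. The curve \<open>C P\<close>
  lies in the window of width \<open>2\<pi>\<close> centred at \<open>P\<close>; hence it projects injectively to the cylinder
  and does not wind around it.
\<close>

definition encircles :: "(real \<times> real) set \<Rightarrow> (real \<times> real) set \<Rightarrow> bool" where
  "encircles L Ps \<longleftrightarrow>
     (\<exists>C. (\<forall>P\<in>Ps. simple_closed_curve (C P) \<and>
                  C P \<subseteq> {fst P - pi<..<fst P + pi} \<times> {-1..1} \<and>
                  inside (C P) \<inter> lift Ps = {P}) \<and>
          (\<forall>P\<in>Ps. \<forall>Q\<in>Ps. P \<noteq> Q \<longrightarrow> lift (C P) \<inter> lift (C Q) = {}) \<and>
          L = (\<Union>P\<in>Ps. lift (C P)))"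

text \<open>\<open>L\<close> consists of two mirror-symmetric curves, each of them a graph over the whole circle.\<close>

definition defined_for_all_g :: "(real \<times> real) set \<Rightarrow> bool" where
  "defined_for_all_g L \<longleftrightarrow>
     (\<exists>\<phi>. continuous_on UNIV \<phi> \<and> (\<forall>g. \<phi> (g + 2 * pi) = \<phi> g) \<and> (\<forall>g. 0 < \<phi> g) \<and>
          L = {(g, G). G = \<phi> g \<or> G = - \<phi> g})"

end

theory Submission
  imports Defs
begin

text \<open>
  With \<open>s = sqrt (1 - G\<^sup>2) \<in> [0,1]\<close> one has \<open>F \<delta> (g, G) = 1 - s\<^sup>2 + \<delta> * s * cos g\<close>, so bounds and extrema
  come from completing the square in \<open>s\<close>, and for \<open>s > 0\<close> the level equation reads
  \<open>cos g = (c - 1 + s\<^sup>2) / (\<delta> * s)\<close>. The values of \<open>s\<close> at which the right-hand side is \<open>\<plusminus>1\<close> are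
  roots of a quadratic; they bound the range of \<open>G\<close> on each component, which is
  then a pair of graphs \<open>g = g\<^sub>0 \<plusminus> arccos (w G)\<close> over a \<open>G\<close>-interval, meeting at its end points.
  A point between the two graphs is in the inside since the region between them is clopen in the
  complement of the curve. A saddle is neither a maximum nor a minimum, which leaves only \<open>P_zero\<close>
  among the critical points.
\<close>

section \<open>Closed curves as pairs of graphs\<close>

text \<open>The phase portrait is read off from the quadratic q(s) = s^2 - \<delta> s cos g + (c -
  1), whose roots in [0, 1] are the points of the level c above g. The product of the roots is c -
  1. For c < 1 there is exactly one positive root for each g, and it is at most 1 iff q(1) = c -
  \<delta> cos g is nonnegative: everywhere if c > \<delta>, which gives graphs over the circle, and
  only near g = pi if c < \<delta>, which gives curves around \<open>P_minus\<close>. For c > 1 a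
  root s > 0 forces cos g > 0, so the curves are centred at g = 0; with cos g = 1 the sign of q(1) =
  c - \<delta> decides whether s = 1, that is G = 0, is reached. If it is, there is one curve around
  the origin, otherwise there are two mirror images. Closed curves are parametrized by G because the
  equation is affine in cos g for fixed G. Two points need more than algebra: \<open>F\<close> has a
  square root singularity at G = 1 and G = -1, so boundary equilibria are excluded by a direct
  estimate, and \<open>saddle\<close> speaks of unspecified derivatives, so saddles at extrema are
  excluded by a general second-order argument.\<close>

lemma mem_lift_iff: "(g, G) \<in> lift S \<longleftrightarrow> (\<exists>k::int. (g - 2 * pi * of_int k, G) \<in> S)"
proof
  assume "(g, G) \<in> lift S"
  then obtain g' and k :: int where "g = g' + 2 * pi * of_int k" "(g', G) \<in> S"
    unfolding lift_def by blast
  moreover from this have "g - 2 * pi * of_int k = g'" by simp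
  ultimately show "\<exists>k::int. (g - 2 * pi * of_int k, G) \<in> S"
    by metis
next
  assume "\<exists>k::int. (g - 2 * pi * of_int k, G) \<in> S"
  then obtain k :: int where "(g - 2 * pi * of_int k, G) \<in> S" by blast
  moreover have "g = (g - 2 * pi * of_int k) + 2 * pi * of_int k" by simp
  ultimately show "(g, G) \<in> lift S"
    unfolding lift_def by blast
qed

lemma lift_empty [simp]: "lift {} = {}"
  by (auto simp: lift_def)

text \<open>The cosine detects multiples of 2 pi, so the integer of the covering disappears from
  later membership questions and only cosine equations remain.\<close>

lemma mem_lift_insert:
  "(g, G) \<in> lift (insert (g\<^sub>0, G\<^sub>0) S) \<longleftrightarrow> cos (g - g\<^sub>0) = 1 \<and> G = G\<^sub>0 \<or> (g, G) \<in> lift S"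
  unfolding mem_lift_iff cos_one_2pi_int by (auto simp: algebra_simps)

lemma cos_diff_period: "cos (g - 2 * pi * of_int k - g\<^sub>0) = cos (g - g\<^sub>0)"
proof -
  have "cos ((g - g\<^sub>0) + 2 * pi * of_int (- k)) = cos (g - g\<^sub>0)"
    by (simp only: cos_add cos_int_2pin sin_int_2pin)
  then show ?thesis by (simp add: algebra_simps)
qed

text \<open>The two halves \<open>g = g\<^sub>0 \<plusminus> arccos (w G)\<close> are graphs over the \<open>G\<close>-interval.\<close>

lemma closed_curve_of_graph_pair:
  fixes w :: "real \<Rightarrow> real"
  assumes ab: "a < b" and w: "continuous_on {a..b} w" and ends: "w a = 1" "w b = 1"
    and mid: "\<And>G. a < G \<Longrightarrow> G < b \<Longrightarrow> \<bar>w G\<bar> < 1"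
  obtains C where "simple_closed_curve C" "C \<subseteq> {g\<^sub>0 - pi<..<g\<^sub>0 + pi} \<times> {a..b}"
    "inside C \<subseteq> {g\<^sub>0 - pi<..<g\<^sub>0 + pi} \<times> {a..b}" "\<And>m. a < m \<Longrightarrow> m < b \<Longrightarrow> (g\<^sub>0, m) \<in> inside C"
    "lift C = {(g, G). G \<in> {a..b} \<and> cos (g - g\<^sub>0) = w G}"
proof -
  define A where "A = (\<lambda>G. arccos (w G))"
  define C where "C = {(g, G). G \<in> {a..b} \<and> \<bar>g - g\<^sub>0\<bar> = A G}"
  \<comment> \<open>The strict bound \<open>-1 < w G\<close> holds at the end points too, where
    \<open>w\<close> is 1. It keeps \<open>arccos (w G)\<close> strictly below pi, hence the curve
    inside the open window of width 2 pi.\<close>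
  have w_bds: "-1 < w G \<and> w G \<le> 1" if "G \<in> {a..b}" for G
    using mid[of G] ends that by (cases "G = a \<or> G = b") auto
  have contA: "continuous_on {a..b} A"
    unfolding A_def using w w_bds by (intro continuous_on_arccos) (auto intro: less_imp_le)
  have A_bds: "0 \<le> A G \<and> A G < pi" if "G \<in> {a..b}" for G
  proof -
    have "arccos (w G) < arccos (-1)"
      using w_bds[OF that] by (intro arccos_less_arccos) auto
    then show ?thesis
      using w_bds[OF that] by (simp add: A_def arccos_lbound)
  qed
  have A_ends: "A a = 0" "A b = 0" by (simp_all add: A_def ends)
  have A_pos: "0 < A G" if "a < G" "G < b" for G
  proof -
    have "arccos 1 < arccos (w G)"
      using mid[OF that] by (intro arccos_less_arccos) auto
    then show ?thesis by (simp add: A_def)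
  qed
  have window: "C \<subseteq> {g\<^sub>0 - pi<..<g\<^sub>0 + pi} \<times> {a..b}"
  proof
    fix p assume "p \<in> C"
    then obtain g G where p: "p = (g, G)" "G \<in> {a..b}" "\<bar>g - g\<^sub>0\<bar> = A G"
      by (auto simp: C_def)
    then show "p \<in> {g\<^sub>0 - pi<..<g\<^sub>0 + pi} \<times> {a..b}"
      using A_bds[of G] by auto
  qed
  have "simple_closed_curve C"
  proof -
    \<comment> \<open>\<open>p\<close> climbs the right half and \<open>q\<close> descends the left
      half; the halves meet exactly where \<open>A\<close> vanishes, that is at the two
      ends.\<close>
    define p where "p = (\<lambda>G. (g\<^sub>0 + A G, G)) \<circ> linepath a b"
    define q where "q = (\<lambda>G. (g\<^sub>0 - A G, G)) \<circ> linepath b a"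
    have seg: "closed_segment a b = {a..b}" "closed_segment b a = {a..b}"
      using ab by (auto simp: closed_segment_eq_real_ivl)
    have "path p" "path q"
      unfolding p_def q_def
      by (intro path_continuous_image continuous_intros contA; simp add: seg contA)+
    moreover have "inj_on p {0..1}" "inj_on q {0..1}"
      unfolding p_def q_def using ab
      by (intro comp_inj_on inj_on_linepath; simp add: inj_on_def)+
    ultimately have "arc p" "arc q" by (simp_all add: arc_def)
    moreover have im: "path_image p = (\<lambda>G. (g\<^sub>0 + A G, G)) ` {a..b}"
      "path_image q = (\<lambda>G. (g\<^sub>0 - A G, G)) ` {a..b}"
      unfolding p_def q_def by (simp_all add: path_image_compose seg)
    moreover have ends': "pathstart p = (g\<^sub>0, a)" "pathfinish p = (g\<^sub>0, b)"
      "pathstart q = (g\<^sub>0, b)" "pathfinish q = (g\<^sub>0, a)"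
      unfolding p_def q_def by (simp_all add: pathstart_compose pathfinish_compose A_ends)
    moreover have "path_image p \<inter> path_image q \<subseteq> {(g\<^sub>0, a), (g\<^sub>0, b)}"
    proof
      fix x assume "x \<in> path_image p \<inter> path_image q"
      then obtain G where G: "G \<in> {a..b}" "x = (g\<^sub>0 + A G, G)" "A G = - A G"
        by (auto simp: im)
      then have "A G = 0" by simp
      then show "x \<in> {(g\<^sub>0, a), (g\<^sub>0, b)}"
        using G A_pos[of G] by (cases "G = a \<or> G = b") auto
    qed
    ultimately have "simple_path (p +++ q)"
      by (intro simple_path_join_loop) auto
    moreover have "path_image (p +++ q) = C"
    proof -
      have "path_image (p +++ q) = path_image p \<union> path_image q"
        by (simp add: path_image_join ends')
      also have "\<dots> = C"
      proof (rule set_eqI, clarify)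
        fix g G
        show "(g, G) \<in> path_image p \<union> path_image q \<longleftrightarrow> (g, G) \<in> C"
        proof (cases "G \<in> {a..b}")
          case True
          then have "0 \<le> A G" using A_bds by blast
          then show ?thesis using True unfolding im C_def by (auto simp: abs_if image_iff)
        qed (auto simp: im C_def)
      qed
      finally show ?thesis .
    qed
    ultimately show ?thesis
      unfolding simple_closed_curve_def using ends' by (intro exI[of _ "p +++ q"]) auto
  qed
  moreover have "inside C \<subseteq> {g\<^sub>0 - pi<..<g\<^sub>0 + pi} \<times> {a..b}"
  proof -
    \<comment> \<open>The window is convex and contains the curve, so no point beyond it can be
      enclosed.\<close>
    have "- ({g\<^sub>0 - pi<..<g\<^sub>0 + pi} \<times> {a..b}) \<subseteq> outside C"
      using window by (intro outside_subset_convex convex_Times) auto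
    then show ?thesis using inside_Int_outside[of C] by blast
  qed
  moreover have "(g\<^sub>0, m) \<in> inside C" if m: "a < m" "m < b" for m
  proof -
    define R where "R = {(g, G). G \<in> {a<..<b} \<and> \<bar>g - g\<^sub>0\<bar> < A G}"
    define R' where "R' = {(g, G). G \<in> {a..b} \<and> \<bar>g - g\<^sub>0\<bar> \<le> A G}"
    have contA2: "continuous_on (UNIV \<times> {a..b}) (\<lambda>p. A (snd p) - \<bar>fst p - g\<^sub>0\<bar>)"
      by (intro continuous_intros continuous_on_compose2[OF contA]) auto
    have "open ((UNIV \<times> {a<..<b}) \<inter> (\<lambda>p. A (snd p) - \<bar>fst p - g\<^sub>0\<bar>) -` {0<..})"
      by (intro continuous_open_preimage open_Times continuous_on_subset[OF contA2]) auto
    moreover have "(UNIV \<times> {a<..<b}) \<inter> (\<lambda>p. A (snd p) - \<bar>fst p - g\<^sub>0\<bar>) -` {0<..} = R"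
      by (auto simp: R_def)
    ultimately have "open R" by simp
    have "closed ((UNIV \<times> {a..b}) \<inter> (\<lambda>p. A (snd p) - \<bar>fst p - g\<^sub>0\<bar>) -` {0..})"
      by (intro continuous_closed_preimage closed_Times contA2) auto
    moreover have "(UNIV \<times> {a..b}) \<inter> (\<lambda>p. A (snd p) - \<bar>fst p - g\<^sub>0\<bar>) -` {0..} = R'"
      by (auto simp: R'_def)
    ultimately have "closed R'" by simp
    have RC: "R' - C \<subseteq> R"
    proof
      fix x assume "x \<in> R' - C"
      then obtain g G where x: "x = (g, G)" "G \<in> {a..b}" "\<bar>g - g\<^sub>0\<bar> < A G"
        by (force simp: R'_def C_def)
      then show "x \<in> R"
        using A_ends by (cases "G = a \<or> G = b") (auto simp: R_def)
    qed
    have "R \<subseteq> R'" "R \<inter> C = {}" by (auto simp: R_def R'_def C_def)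
    have "(g\<^sub>0, m) \<in> R" using m A_pos by (auto simp: R_def)
    define K where "K = connected_component_set (- C) (g\<^sub>0, m)"
    have "(g\<^sub>0, m) \<in> - C" using \<open>(g\<^sub>0, m) \<in> R\<close> \<open>R \<inter> C = {}\<close> by blast
    then have "(g\<^sub>0, m) \<in> K" by (simp add: K_def)
    have "connected K" "K \<subseteq> - C"
      by (auto simp: K_def connected_component_subset)
    then have "R \<inter> K = {} \<or> (- R') \<inter> K = {}"
      using \<open>open R\<close> \<open>closed R'\<close> \<open>R \<subseteq> R'\<close> RC by (intro connectedD) auto
    then have "K \<subseteq> R'" using \<open>(g\<^sub>0, m) \<in> K\<close> \<open>(g\<^sub>0, m) \<in> R\<close> by blast
    also have "R' \<subseteq> {g\<^sub>0 - pi..g\<^sub>0 + pi} \<times> {a..b}"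
    proof
      fix x assume "x \<in> R'"
      then obtain g G where x: "x = (g, G)" "G \<in> {a..b}" "\<bar>g - g\<^sub>0\<bar> \<le> A G"
        by (auto simp: R'_def)
      then show "x \<in> {g\<^sub>0 - pi..g\<^sub>0 + pi} \<times> {a..b}" using A_bds[of G] by auto
    qed
    finally have "bounded K"
      by (rule bounded_subset[rotated]) (intro bounded_Times bounded_closed_interval)
    then show ?thesis
      using \<open>(g\<^sub>0, m) \<in> - C\<close> by (simp add: inside_def K_def)
  qed
  moreover have "lift C = {(g, G). G \<in> {a..b} \<and> cos (g - g\<^sub>0) = w G}"
  proof (rule set_eqI, clarify)
    fix g G
    show "(g, G) \<in> lift C \<longleftrightarrow> (g, G) \<in> {(g, G). G \<in> {a..b} \<and> cos (g - g\<^sub>0) = w G}"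
    proof
      assume "(g, G) \<in> lift C"
      then obtain k :: int where k: "G \<in> {a..b}" "\<bar>g - 2 * pi * of_int k - g\<^sub>0\<bar> = A G"
        by (auto simp: mem_lift_iff C_def)
      have "cos (g - g\<^sub>0) = cos \<bar>g - 2 * pi * of_int k - g\<^sub>0\<bar>"
        by (simp add: cos_diff_period)
      also have "\<dots> = w G"
        using w_bds[OF k(1)] k(2) by (simp add: A_def)
      finally show "(g, G) \<in> {(g, G). G \<in> {a..b} \<and> cos (g - g\<^sub>0) = w G}"
        using k by simp
    next
      assume "(g, G) \<in> {(g, G). G \<in> {a..b} \<and> cos (g - g\<^sub>0) = w G}"
      then have G: "G \<in> {a..b}" "cos (g - g\<^sub>0) = w G" by auto
      \<comment> \<open>Rounding picks the translate of \<open>g\<close> nearest to the centre. Its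
        distance to the centre is at most pi, the range on which \<open>arccos\<close> inverts
        \<open>cos\<close>.\<close>
      define k where "k = round ((g - g\<^sub>0) / (2 * pi))"
      have "\<bar>of_int k - (g - g\<^sub>0) / (2 * pi)\<bar> * (2 * pi) \<le> 1 / 2 * (2 * pi)"
        unfolding k_def by (intro mult_right_mono of_int_round_abs_le) auto
      also have "\<bar>of_int k - (g - g\<^sub>0) / (2 * pi)\<bar> * (2 * pi) = \<bar>(of_int k - (g - g\<^sub>0) / (2 * pi)) * (2 * pi)\<bar>"
        by (simp add: abs_mult)
      also have "(of_int k - (g - g\<^sub>0) / (2 * pi)) * (2 * pi) = - (g - 2 * pi * of_int k - g\<^sub>0)"
        by (simp add: field_simps)
      finally have le: "\<bar>g - 2 * pi * of_int k - g\<^sub>0\<bar> \<le> pi" by simp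
      have "\<bar>g - 2 * pi * of_int k - g\<^sub>0\<bar> = arccos (cos \<bar>g - 2 * pi * of_int k - g\<^sub>0\<bar>)"
        using le by (intro arccos_cos[symmetric]) auto
      also have "\<dots> = A G"
        using G by (simp add: cos_diff_period A_def)
      finally show "(g, G) \<in> lift C"
        using G by (auto simp: mem_lift_iff C_def)
    qed
  qed
  ultimately show thesis using window that by blast
qed

section \<open>Level sets\<close>

lemma F_eq:
  assumes "G \<in> {-1..1}"
  shows "F \<delta> (g, G) = 1 - (sqrt (1 - G\<^sup>2))\<^sup>2 + \<delta> * sqrt (1 - G\<^sup>2) * cos g"
proof -
  have "G\<^sup>2 \<le> 1" using assms by (simp add: abs_square_le_1 abs_le_iff)
  then show ?thesis by (simp add: F_def)
qed

lemma sqrt_one_minus_sq: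
  assumes "G \<in> {-1..1::real}"
  shows "0 \<le> sqrt (1 - G\<^sup>2)" "sqrt (1 - G\<^sup>2) \<le> 1" "(sqrt (1 - G\<^sup>2))\<^sup>2 = 1 - G\<^sup>2"
proof -
  have "G\<^sup>2 \<le> 1" using assms by (simp add: abs_square_le_1 abs_le_iff)
  then show "0 \<le> sqrt (1 - G\<^sup>2)" "sqrt (1 - G\<^sup>2) \<le> 1" "(sqrt (1 - G\<^sup>2))\<^sup>2 = 1 - G\<^sup>2"
    by auto
qed

lemma mem_level_iff:
  "(g, G) \<in> level \<delta> c \<longleftrightarrow>
     G \<in> {-1..1} \<and> 1 - (sqrt (1 - G\<^sup>2))\<^sup>2 + \<delta> * sqrt (1 - G\<^sup>2) * cos g = c"
  using F_eq[of G \<delta> g] by (auto simp: level_def strip_def)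

text \<open>For \<open>0 < s = sqrt (1 - G\<^sup>2)\<close> the equation \<open>F \<delta> (g, G) = c\<close> is solved for \<open>cos g\<close>.\<close>

definition level_cos :: "real \<Rightarrow> real \<Rightarrow> real \<Rightarrow> real" where
  "level_cos \<delta> c s = (c - 1 + s\<^sup>2) / (\<delta> * s)"

lemma level_cos_iff:
  assumes "0 < \<delta>" "0 < s"
  shows "1 - s\<^sup>2 + \<delta> * s * x = c \<longleftrightarrow> x = level_cos \<delta> c s"
  using assms by (auto simp: level_cos_def field_simps)

lemma mem_level_iff_level_cos:
  assumes "0 < \<delta>" "\<bar>G\<bar> < 1"
  shows "(g, G) \<in> level \<delta> c \<longleftrightarrow> cos g = level_cos \<delta> c (sqrt (1 - G\<^sup>2))"
proof -
  have "0 < sqrt (1 - G\<^sup>2)" using assms by (simp add: abs_square_less_1)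
  moreover have "G \<in> {-1..1}" using assms by auto
  ultimately show ?thesis by (simp only: mem_level_iff level_cos_iff[OF \<open>0 < \<delta>\<close>] simp_thms)
qed

lemma level_cos_bounds:
  assumes "0 < \<delta>" "0 < s" "- (\<delta> * s) < c - 1 + s\<^sup>2" "c - 1 + s\<^sup>2 < \<delta> * s"
  shows "\<bar>level_cos \<delta> c s\<bar> < 1"
  using assms by (simp add: level_cos_def abs_less_iff field_simps)

text \<open>Both sides say r^2 + x^2 < 1. The map r -> sqrt (1 - r^2) is a decreasing involution of
  [0, 1], which is how bounds on s become bounds on the absolute value of G and conversely.\<close>

lemma sqrt_one_minus_sq_less_iff:
  assumes "0 \<le> r" "r \<le> 1" "0 \<le> x" "x \<le> (1::real)"
  shows "r < sqrt (1 - x\<^sup>2) \<longleftrightarrow> x < sqrt (1 - r\<^sup>2)"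
proof -
  have "r < sqrt (1 - x\<^sup>2) \<longleftrightarrow> r\<^sup>2 < 1 - x\<^sup>2"
    using assms by (metis real_less_rsqrt real_sqrt_less_iff real_sqrt_abs abs_of_nonneg)
  moreover have "x < sqrt (1 - r\<^sup>2) \<longleftrightarrow> x\<^sup>2 < 1 - r\<^sup>2"
    using assms by (metis real_less_rsqrt real_sqrt_less_iff real_sqrt_abs abs_of_nonneg)
  ultimately show ?thesis by linarith
qed

lemma sqrt_one_minus_sq_idem:
  assumes "0 \<le> r" "r \<le> (1::real)"
  shows "sqrt (1 - (sqrt (1 - r\<^sup>2))\<^sup>2) = r"
  using sqrt_one_minus_sq[of r] assms by simp

lemma continuous_on_level_cos:
  assumes "-1 < a" "b < 1" "0 < \<delta>"
  shows "continuous_on {a..b} (\<lambda>G. level_cos \<delta> c (sqrt (1 - G\<^sup>2)))"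
proof -
  have "G\<^sup>2 \<noteq> 1" if "G \<in> {a..b}" for G
    using that assms by (auto simp: power2_eq_1_iff)
  then show ?thesis
    unfolding level_cos_def using assms by (intro continuous_intros) auto
qed

section \<open>Closed level curves and the points they encircle\<close>

text \<open>This is the case in which the admissible values of s form [\<open>s\<^sub>0\<close>, 1].
  That interval contains s = 1, i.e. G = 0, so the values of G form one symmetric interval and carry
  one curve. The sign \<open>\<sigma>\<close> treats both possible centres at once: it is 1 for a
  centre at 0 and -1 for a centre at pi.\<close>

lemma encircles_single:
  assumes "0 < \<delta>" "0 < s\<^sub>0" "s\<^sub>0 < 1"
    and \<sigma>: "\<sigma> = 1 \<or> \<sigma> = -1" "\<And>g. cos (g - g\<^sub>0) = \<sigma> * cos g"
    and end0: "\<sigma> * level_cos \<delta> c s\<^sub>0 = 1"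
    and mid: "\<And>s. s\<^sub>0 < s \<Longrightarrow> s \<le> 1 \<Longrightarrow> \<bar>level_cos \<delta> c s\<bar> < 1"
    and out: "\<And>s x. 0 \<le> s \<Longrightarrow> s < s\<^sub>0 \<Longrightarrow> \<bar>x\<bar> \<le> 1 \<Longrightarrow> 1 - s\<^sup>2 + \<delta> * s * x \<noteq> c"
  shows "encircles (level \<delta> c) {(g\<^sub>0, 0)}"
proof -
  define r where "r = sqrt (1 - s\<^sub>0\<^sup>2)"
  define w where "w = (\<lambda>G. \<sigma> * level_cos \<delta> c (sqrt (1 - G\<^sup>2)))"
  have "s\<^sub>0\<^sup>2 < 1" "0 < s\<^sub>0\<^sup>2" using assms by (simp_all add: power_less_one_iff)
  then have r: "0 < r" "r < 1" by (auto simp: r_def)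
  have rs: "sqrt (1 - r\<^sup>2) = s\<^sub>0"
    unfolding r_def using assms by (intro sqrt_one_minus_sq_idem) auto
  have less: "\<bar>G\<bar> < r \<longleftrightarrow> s\<^sub>0 < sqrt (1 - G\<^sup>2)" "r < \<bar>G\<bar> \<longleftrightarrow> sqrt (1 - G\<^sup>2) < s\<^sub>0" if "\<bar>G\<bar> \<le> 1" for G
  proof -
    show *: "\<bar>G\<bar> < r \<longleftrightarrow> s\<^sub>0 < sqrt (1 - G\<^sup>2)"
      using sqrt_one_minus_sq_less_iff[of s\<^sub>0 "\<bar>G\<bar>"] that assms unfolding r_def by simp
    show "r < \<bar>G\<bar> \<longleftrightarrow> sqrt (1 - G\<^sup>2) < s\<^sub>0"
    proof (cases "\<bar>G\<bar> = r")
      case True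
      then have "G\<^sup>2 = r\<^sup>2" by (metis power2_abs)
      then show ?thesis using rs True by simp
    next
      case False
      have "sqrt (1 - G\<^sup>2) \<noteq> s\<^sub>0"
        using False that by (metis abs_ge_zero less_eq_real_def power2_abs r_def sqrt_one_minus_sq_idem)
      then show ?thesis using * False by linarith
    qed
  qed
  have wc: "continuous_on {-r..r} w"
    unfolding w_def using r assms by (intro continuous_intros continuous_on_level_cos) auto
  have we: "w (-r) = 1" "w r = 1" using end0 by (simp_all add: w_def rs)
  have wm: "\<bar>w G\<bar> < 1" if "-r < G" "G < r" for G
  proof -
    have "\<bar>G\<bar> \<le> 1" "\<bar>G\<bar> < r" using that r by auto
    then have "s\<^sub>0 < sqrt (1 - G\<^sup>2)" "sqrt (1 - G\<^sup>2) \<le> 1" using less by auto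
    then show ?thesis using mid \<sigma>(1) by (auto simp: w_def abs_mult)
  qed
  have "-r < r" using r by simp
  from closed_curve_of_graph_pair[OF this wc we wm, where g\<^sub>0 = g\<^sub>0] obtain C where
    C: "simple_closed_curve C" "C \<subseteq> {g\<^sub>0 - pi<..<g\<^sub>0 + pi} \<times> {-r..r}"
    "inside C \<subseteq> {g\<^sub>0 - pi<..<g\<^sub>0 + pi} \<times> {-r..r}"
    and inC: "\<And>m. -r < m \<Longrightarrow> m < r \<Longrightarrow> (g\<^sub>0, m) \<in> inside C"
    and lC: "lift C = {(g, G). G \<in> {-r..r} \<and> cos (g - g\<^sub>0) = w G}" by blast
  have "level \<delta> c = lift C"
  proof (rule set_eqI, clarify)
    fix g G
    show "(g, G) \<in> level \<delta> c \<longleftrightarrow> (g, G) \<in> lift C"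
    proof (cases "G \<in> {-r..r}")
      case True
      then have "\<bar>G\<bar> < 1" using r by auto
      then have "(g, G) \<in> level \<delta> c \<longleftrightarrow> cos g = level_cos \<delta> c (sqrt (1 - G\<^sup>2))"
        using assms by (intro mem_level_iff_level_cos)
      also have "\<dots> \<longleftrightarrow> cos (g - g\<^sub>0) = w G"
        using \<sigma> by (auto simp: w_def)
      finally show ?thesis using True by (simp add: lC)
    next
      case False
      then have "r < \<bar>G\<bar>" by auto
      then have "(g, G) \<notin> level \<delta> c"
        using less(2)[of G] sqrt_one_minus_sq[of G] out[of "sqrt (1 - G\<^sup>2)" "cos g"]
        by (auto simp: mem_level_iff abs_le_iff)
      then show ?thesis using False by (auto simp: lC)
    qed
  qed
  moreover have "inside C \<inter> lift {(g\<^sub>0, 0)} = {(g\<^sub>0, 0)}"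
  proof -
    have "(g, G) = (g\<^sub>0, 0)" if "(g, G) \<in> inside C" "(g, G) \<in> lift {(g\<^sub>0, 0)}" for g G
    proof -
      have "cos (g - g\<^sub>0) = 1" "G = 0" using that by (simp_all add: mem_lift_insert)
      moreover have "\<bar>g - g\<^sub>0\<bar> < pi" using that C(3) by (auto simp: abs_less_iff)
      ultimately have "\<bar>g - g\<^sub>0\<bar> = 0"
        using arccos_cos[of "\<bar>g - g\<^sub>0\<bar>"] by simp
      then show ?thesis using \<open>G = 0\<close> by simp
    qed
    moreover have "(g\<^sub>0, 0) \<in> inside C" using inC r by simp
    ultimately show ?thesis by (auto simp: mem_lift_insert)
  qed
  moreover have "C \<subseteq> {g\<^sub>0 - pi<..<g\<^sub>0 + pi} \<times> {-1..1}" using C(2) r by auto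
  ultimately show ?thesis
    unfolding encircles_def using C(1) by (intro exI[of _ "\<lambda>_. C"]) auto
qed

text \<open>Here the admissible values of s form [\<open>s\<^sub>1\<close>,
  \<open>s\<^sub>2\<close>] with \<open>s\<^sub>2 < 1\<close>. This excludes G = 0, so the values of
  G split into an interval [a, b] with a > 0 and its mirror image, each carrying its own curve. Any
  height \<open>m\<close> strictly between a and b is enclosed.\<close>

lemma encircles_mirror_pair:
  assumes "0 < \<delta>" "0 < s\<^sub>1" "s\<^sub>1 < s\<^sub>2" "s\<^sub>2 < 1"
    and ends: "level_cos \<delta> c s\<^sub>1 = 1" "level_cos \<delta> c s\<^sub>2 = 1"
    and mid: "\<And>s. s\<^sub>1 < s \<Longrightarrow> s < s\<^sub>2 \<Longrightarrow> \<bar>level_cos \<delta> c s\<bar> < 1"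
    and out: "\<And>s x. 0 \<le> s \<Longrightarrow> s < s\<^sub>1 \<or> s\<^sub>2 < s \<Longrightarrow> \<bar>x\<bar> \<le> 1 \<Longrightarrow> 1 - s\<^sup>2 + \<delta> * s * x \<noteq> c"
    and m: "sqrt (1 - s\<^sub>2\<^sup>2) < m" "m < sqrt (1 - s\<^sub>1\<^sup>2)"
  shows "encircles (level \<delta> c) {(0, m), (0, - m)}"
proof -
  define a where "a = sqrt (1 - s\<^sub>2\<^sup>2)"
  define b where "b = sqrt (1 - s\<^sub>1\<^sup>2)"
  define w where "w = (\<lambda>G. level_cos \<delta> c (sqrt (1 - G\<^sup>2)))"
  have "s\<^sub>2\<^sup>2 < 1" "0 < s\<^sub>1\<^sup>2" "s\<^sub>1\<^sup>2 < s\<^sub>2\<^sup>2"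
    using assms by (simp_all add: power_less_one_iff power_strict_mono)
  then have ab: "0 < a" "a < b" "b < 1" using m by (auto simp: a_def b_def)
  have rs: "sqrt (1 - a\<^sup>2) = s\<^sub>2" "sqrt (1 - b\<^sup>2) = s\<^sub>1"
    unfolding a_def b_def using assms by (intro sqrt_one_minus_sq_idem; simp)+
  have s_mid: "s\<^sub>1 < sqrt (1 - G\<^sup>2)" "sqrt (1 - G\<^sup>2) < s\<^sub>2" if "a < \<bar>G\<bar>" "\<bar>G\<bar> < b" for G
  proof -
    show "s\<^sub>1 < sqrt (1 - G\<^sup>2)"
      using sqrt_one_minus_sq_less_iff[of s\<^sub>1 "\<bar>G\<bar>"] that ab assms unfolding b_def by simp
    have "sqrt (1 - G\<^sup>2) < sqrt (1 - a\<^sup>2)"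
      using that ab power_strict_mono[of a "\<bar>G\<bar>" 2] by simp
    then show "sqrt (1 - G\<^sup>2) < s\<^sub>2" by (simp add: rs)
  qed
  have s_out: "sqrt (1 - G\<^sup>2) < s\<^sub>1 \<or> s\<^sub>2 < sqrt (1 - G\<^sup>2)"
    if "\<not> (a \<le> \<bar>G\<bar> \<and> \<bar>G\<bar> \<le> b)" for G
  proof (cases "b < \<bar>G\<bar>")
    case True
    have "sqrt (1 - G\<^sup>2) < sqrt (1 - b\<^sup>2)"
      using True ab power_strict_mono[of b "\<bar>G\<bar>" 2] by simp
    then show ?thesis by (simp add: rs)
  next
    case False
    then have "\<bar>G\<bar> < a" using that by auto
    then have "sqrt (1 - a\<^sup>2) < sqrt (1 - G\<^sup>2)"
      using ab power_strict_mono[of "\<bar>G\<bar>" a 2] by simp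
    then show ?thesis by (simp add: rs)
  qed
  have we: "w a = 1" "w b = 1" "w (-a) = 1" "w (-b) = 1"
    using ends by (simp_all add: w_def rs)
  have wm: "\<bar>w G\<bar> < 1" if "a < \<bar>G\<bar>" "\<bar>G\<bar> < b" for G
    using mid s_mid[OF that] by (simp add: w_def)
  have wc: "continuous_on {a..b} w" "continuous_on {-b..-a} w"
    unfolding w_def using ab assms by (intro continuous_on_level_cos; simp)+
  have wm': "\<bar>w G\<bar> < 1" if "a < G" "G < b" for G using wm that ab by auto
  from closed_curve_of_graph_pair[OF ab(2) wc(1) we(1,2) wm', where g\<^sub>0 = 0] obtain C where
    C: "simple_closed_curve C" "C \<subseteq> {0 - pi<..<0 + pi} \<times> {a..b}"
    "inside C \<subseteq> {0 - pi<..<0 + pi} \<times> {a..b}"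
    and inC: "\<And>m. a < m \<Longrightarrow> m < b \<Longrightarrow> (0, m) \<in> inside C"
    and lC: "lift C = {(g, G). G \<in> {a..b} \<and> cos (g - 0) = w G}" by blast
  have wm'': "\<bar>w G\<bar> < 1" if "-b < G" "G < -a" for G using wm that ab by auto
  have "-b < -a" using ab by simp
  from closed_curve_of_graph_pair[OF this wc(2) we(4,3) wm'', where g\<^sub>0 = 0] obtain D where
    D: "simple_closed_curve D" "D \<subseteq> {0 - pi<..<0 + pi} \<times> {-b..-a}"
    "inside D \<subseteq> {0 - pi<..<0 + pi} \<times> {-b..-a}"
    and inD: "\<And>m. -b < m \<Longrightarrow> m < -a \<Longrightarrow> (0, m) \<in> inside D"
    and lD: "lift D = {(g, G). G \<in> {-b..-a} \<and> cos (g - 0) = w G}" by blast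
  have "level \<delta> c = lift C \<union> lift D"
  proof (rule set_eqI, clarify)
    fix g G
    show "(g, G) \<in> level \<delta> c \<longleftrightarrow> (g, G) \<in> lift C \<union> lift D"
    proof (cases "a \<le> \<bar>G\<bar> \<and> \<bar>G\<bar> \<le> b")
      case True
      then have "\<bar>G\<bar> < 1" using ab by simp
      then have "(g, G) \<in> level \<delta> c \<longleftrightarrow> cos g = w G"
        unfolding w_def using assms by (intro mem_level_iff_level_cos)
      then show ?thesis using True by (auto simp: lC lD)
    next
      case False
      then have "(g, G) \<notin> level \<delta> c"
        using s_out[of G] sqrt_one_minus_sq[of G] out[of "sqrt (1 - G\<^sup>2)" "cos g"]
        by (auto simp: mem_level_iff abs_le_iff)
      then show ?thesis using False ab by (auto simp: lC lD)
    qed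
  qed
  moreover have g0: "g = 0" if "cos g = 1" "\<bar>g\<bar> < pi" for g :: real
    using that arccos_cos[of "\<bar>g\<bar>"] by simp
  have m': "a < m" "m < b" using m by (simp_all add: a_def b_def)
  have "inside C \<inter> lift {(0, m), (0, - m)} = {(0, m)}"
  proof -
    have "(g, G) = (0, m)" if "(g, G) \<in> inside C" "(g, G) \<in> lift {(0, m), (0, -m)}" for g G
      using that C(3) g0[of g] ab m' by (auto simp: mem_lift_insert abs_less_iff)
    then have "inside C \<inter> lift {(0, m), (0, - m)} \<subseteq> {(0, m)}"
      by (metis IntE singletonI subsetI surj_pair)
    moreover have "(0, m) \<in> inside C" using inC m' by simp
    moreover have "(0, m) \<in> lift {(0, m), (0, - m)}" by (simp add: mem_lift_insert)
    ultimately show ?thesis by blast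
  qed
  moreover have "inside D \<inter> lift {(0, m), (0, - m)} = {(0, - m)}"
  proof -
    have "(g, G) = (0, - m)" if "(g, G) \<in> inside D" "(g, G) \<in> lift {(0, m), (0, -m)}" for g G
      using that D(3) g0[of g] ab m' by (auto simp: mem_lift_insert abs_less_iff)
    then have "inside D \<inter> lift {(0, m), (0, - m)} \<subseteq> {(0, - m)}"
      by (metis IntE singletonI subsetI surj_pair)
    moreover have "(0, - m) \<in> inside D" using inD m' by simp
    moreover have "(0, - m) \<in> lift {(0, m), (0, - m)}" by (simp add: mem_lift_insert)
    ultimately show ?thesis by blast
  qed
  moreover have "lift C \<inter> lift D = {}" using ab by (auto simp: lC lD)
  moreover have "C \<subseteq> {0 - pi<..<0 + pi} \<times> {-1..1}" "D \<subseteq> {0 - pi<..<0 + pi} \<times> {-1..1}"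
    using C(2) D(2) ab by auto
  ultimately show ?thesis
    unfolding encircles_def using C(1) D(1) m' ab
    by (intro exI[of _ "\<lambda>P. if P = (0, m) then C else D"]) auto
qed

text \<open>Near g = pi the curve closes where cos g = -1. As s grows from that point to 1, cos g
  stays strictly below 1 because c lies below both \<delta> and 1, so the two halves do not meet
  again before the mirror end point.\<close>

lemma encircles_P_minus:
  assumes "0 < \<delta>" "- \<delta> < c" "c < \<delta>" "c < 1"
  shows "encircles (level \<delta> c) {P_minus}"
proof -
  \<comment> \<open>The positive root of s^2 + \<delta> s = 1 - c, which is the level equation at
    cos g = -1. It is positive because c < 1 and below 1 because c > -\<delta>.\<close>
  define s\<^sub>0 where "s\<^sub>0 = (sqrt (\<delta>\<^sup>2 + 4 * (1 - c)) - \<delta>) / 2"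
  have sq: "(sqrt (\<delta>\<^sup>2 + 4 * (1 - c)))\<^sup>2 = \<delta>\<^sup>2 + 4 * (1 - c)" using assms by simp
  have root: "s\<^sub>0\<^sup>2 + \<delta> * s\<^sub>0 = 1 - c"
    using sq by (simp add: s\<^sub>0_def power2_eq_square field_simps)
  have "\<delta> < sqrt (\<delta>\<^sup>2 + 4 * (1 - c))" using assms by (intro real_less_rsqrt) simp
  then have "0 < s\<^sub>0" by (simp add: s\<^sub>0_def)
  have "sqrt (\<delta>\<^sup>2 + 4 * (1 - c)) < 2 + \<delta>"
    using assms by (intro real_less_lsqrt) (auto simp: power2_eq_square algebra_simps)
  then have "s\<^sub>0 < 1" by (simp add: s\<^sub>0_def)
  have "encircles (level \<delta> c) {(pi, 0)}"
  proof (rule encircles_single[where s\<^sub>0 = s\<^sub>0 and \<sigma> = "-1"])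
    show "-1 * level_cos \<delta> c s\<^sub>0 = 1"
      using root \<open>0 < s\<^sub>0\<close> assms by (simp add: level_cos_def field_simps)
    show "\<bar>level_cos \<delta> c s\<bar> < 1" if s: "s\<^sub>0 < s" "s \<le> 1" for s
    proof (rule level_cos_bounds)
      show "0 < s" using s \<open>0 < s\<^sub>0\<close> by simp
      have "s\<^sub>0\<^sup>2 < s\<^sup>2" "\<delta> * s\<^sub>0 < \<delta> * s" using s \<open>0 < s\<^sub>0\<close> assms by (simp_all add: power_strict_mono)
      then show "- (\<delta> * s) < c - 1 + s\<^sup>2" using root by linarith
      \<comment> \<open>The chain is c - 1 + s^2 \<le> c - 1 + s \<le> s c < \<delta> s; the middle
        inequality is (1 - s) (1 - c) \<ge> 0.\<close>
      have "s\<^sup>2 \<le> s" using s \<open>0 < s\<close> by (simp add: power2_eq_square mult_left_le_one_le)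
      moreover have "0 \<le> (1 - s) * (1 - c)" using s assms by (intro mult_nonneg_nonneg) auto
      moreover have "0 < s * (\<delta> - c)" using \<open>0 < s\<close> assms by simp
      ultimately show "c - 1 + s\<^sup>2 < \<delta> * s" by (simp add: algebra_simps)
    qed (fact assms)
    show "1 - s\<^sup>2 + \<delta> * s * x \<noteq> c" if s: "0 \<le> s" "s < s\<^sub>0" "\<bar>x\<bar> \<le> 1" for s x
    proof -
      have "s\<^sup>2 < s\<^sub>0\<^sup>2" "\<delta> * s < \<delta> * s\<^sub>0" using s assms by (simp_all add: power_strict_mono)
      moreover have "\<delta> * s * (-1) \<le> \<delta> * s * x" using s assms by (intro mult_left_mono) auto
      ultimately show ?thesis using root by linarith
    qed
  qed (use \<open>0 < s\<^sub>0\<close> \<open>s\<^sub>0 < 1\<close> assms in \<open>auto simp: cos_diff\<close>)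
  then show ?thesis by (simp add: P_minus_def)
qed

text \<open>For \<open>c > 1\<close>, \<open>cos g \<le> 1\<close> on the level set confines \<open>s\<close> between the roots of
  \<open>s\<^sup>2 - \<delta> * s + (c - 1)\<close>.\<close>

lemma roots_above_one:
  fixes \<delta> c :: real
  assumes "0 < \<delta>" "1 < c" "c < 1 + \<delta>\<^sup>2 / 4"
  obtains s\<^sub>1 s\<^sub>2 where "0 < s\<^sub>1" "s\<^sub>1 < \<delta> / 2" "\<delta> / 2 < s\<^sub>2" "s\<^sub>1 + s\<^sub>2 = \<delta>" "s\<^sub>1 * s\<^sub>2 = c - 1"
proof
  \<comment> \<open>The root of the discriminant. The bound c < 1 + \<delta>^2 / 4 makes it
    positive, and c > 1 makes it smaller than \<delta>, so that the lower root is positive.\<close>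
  define D where "D = sqrt (\<delta>\<^sup>2 - 4 * (c - 1))"
  have "D\<^sup>2 = \<delta>\<^sup>2 - 4 * (c - 1)" using assms by (simp add: D_def)
  then show "(\<delta> - D) / 2 * ((\<delta> + D) / 2) = c - 1" by (simp add: power2_eq_square field_simps)
  have "0 < D" using assms by (simp add: D_def)
  then show "(\<delta> - D) / 2 < \<delta> / 2" "\<delta> / 2 < (\<delta> + D) / 2" by auto
  have "D < \<delta>" unfolding D_def using assms by (intro real_less_lsqrt) auto
  then show "0 < (\<delta> - D) / 2" by simp
  show "(\<delta> - D) / 2 + (\<delta> + D) / 2 = \<delta>" by (simp add: field_simps)
qed

context
  fixes \<delta> c s\<^sub>1 s\<^sub>2 :: real
  assumes pos: "0 < \<delta>" "1 < c" and s\<^sub>1: "0 < s\<^sub>1" and le: "s\<^sub>1 < s\<^sub>2"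
    and sum: "s\<^sub>1 + s\<^sub>2 = \<delta>" and prod: "s\<^sub>1 * s\<^sub>2 = c - 1"
begin

lemma quadratic_factor: "s\<^sup>2 - \<delta> * s + (c - 1) = (s - s\<^sub>1) * (s - s\<^sub>2)"
  unfolding sum[symmetric] prod[symmetric] by (simp add: power2_eq_square algebra_simps)

lemma level_cos_at_root: "s = s\<^sub>1 \<or> s = s\<^sub>2 \<Longrightarrow> level_cos \<delta> c s = 1"
  using quadratic_factor[of s] pos s\<^sub>1 le by (auto simp: level_cos_def field_simps)

text \<open>The upper bound is the negativity of the quadratic between its roots; the lower bound is
  automatic, since c > 1 makes the numerator c - 1 + s^2 positive.\<close>

lemma level_cos_between_roots:
  assumes "s\<^sub>1 < s" "s < s\<^sub>2"
  shows "\<bar>level_cos \<delta> c s\<bar> < 1"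
proof (rule level_cos_bounds)
  have "(s - s\<^sub>1) * (s - s\<^sub>2) < 0" using assms by (simp add: mult_less_0_iff)
  then show "c - 1 + s\<^sup>2 < \<delta> * s" using quadratic_factor[of s] by linarith
  show "0 < s" using assms s\<^sub>1 by simp
  then have "0 < \<delta> * s" using pos by simp
  then show "- (\<delta> * s) < c - 1 + s\<^sup>2" using pos zero_le_power2[of s] by linarith
qed (fact pos)

lemma level_outside_roots:
  assumes "0 \<le> s" "s < s\<^sub>1 \<or> s\<^sub>2 < s" "\<bar>x\<bar> \<le> 1"
  shows "1 - s\<^sup>2 + \<delta> * s * x \<noteq> c"
proof -
  have "0 < (s - s\<^sub>1) * (s - s\<^sub>2)" using assms le by (auto simp: zero_less_mult_iff)
  moreover have "\<delta> * s * x \<le> \<delta> * s * 1" using assms pos by (intro mult_left_mono) auto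
  ultimately show ?thesis using quadratic_factor[of s] by linarith
qed

end

text \<open>At s = 1 the quadratic equals c - \<delta> < 0, so 1 lies between the roots and only
  \<open>s\<^sub>1\<close> bounds the range of s. No upper bound on \<delta> is imposed, so the
  result covers the curves around the saddle for \<delta> \<le> 2 and those around the maximum at
  the origin for \<delta> > 2.\<close>

lemma encircles_P_zero:
  assumes "0 < \<delta>" "1 < c" "c < \<delta>"
  shows "encircles (level \<delta> c) {P_zero}"
proof -
  \<comment> \<open>This square expresses \<delta> \<le> 1 + \<delta>^2 / 4, so c < \<delta>
    suffices for two distinct roots.\<close>
  have "0 \<le> (\<delta> - 2)\<^sup>2" by simp
  then have "c < 1 + \<delta>\<^sup>2 / 4" using assms by (simp add: power2_eq_square algebra_simps)
  then obtain s\<^sub>1 s\<^sub>2 where s: "0 < s\<^sub>1" "s\<^sub>1 < \<delta> / 2" "\<delta> / 2 < s\<^sub>2" "s\<^sub>1 + s\<^sub>2 = \<delta>" "s\<^sub>1 * s\<^sub>2 = c - 1"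
    using roots_above_one assms by metis
  then have "s\<^sub>1 < s\<^sub>2" by linarith
  note roots = assms(1,2) s(1) this s(4,5)
  have "(1 - s\<^sub>1) * (1 - s\<^sub>2) < 0" using quadratic_factor[OF roots, of 1] assms by simp
  then have s1: "s\<^sub>1 < 1" "1 < s\<^sub>2" using \<open>s\<^sub>1 < s\<^sub>2\<close> by (auto simp: mult_less_0_iff)
  have "encircles (level \<delta> c) {(0, 0)}"
    by (rule encircles_single[where s\<^sub>0 = s\<^sub>1 and \<sigma> = 1])
      (use assms s s1 level_cos_at_root[OF roots, of s\<^sub>1] level_cos_between_roots[OF roots]
         level_outside_roots[OF roots] in auto)
  then show ?thesis by (simp add: P_zero_def)
qed

text \<open>Now the quadratic at s = 1 equals c - \<delta> > 0, so 1 is not between the roots. The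
  smaller root is below \<delta> / 2 < 1, hence both are below 1. The maximum sits at s = \<delta> /
  2, the midpoint of the roots, so its height lies strictly between the ends of the curve.\<close>

lemma encircles_P_plus:
  assumes "0 < \<delta>" "\<delta> \<le> 2" "1 < c" "\<delta> < c" "c < 1 + \<delta>\<^sup>2 / 4"
  shows "encircles (level \<delta> c) {P_plus \<delta>, mirror (P_plus \<delta>)}"
proof -
  \<comment> \<open>At \<delta> = 2 the bounds \<delta> and 1 + \<delta>^2 / 4 for c coincide and
    leave no room.\<close>
  have "\<delta> \<noteq> 2" using assms by auto
  then have "\<delta> < 2" using assms by simp
  obtain s\<^sub>1 s\<^sub>2 where s: "0 < s\<^sub>1" "s\<^sub>1 < \<delta> / 2" "\<delta> / 2 < s\<^sub>2" "s\<^sub>1 + s\<^sub>2 = \<delta>" "s\<^sub>1 * s\<^sub>2 = c - 1"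
    using roots_above_one assms by metis
  then have "s\<^sub>1 < s\<^sub>2" by linarith
  note roots = assms(1,3) s(1) this s(4,5)
  have "0 < (1 - s\<^sub>1) * (1 - s\<^sub>2)" using quadratic_factor[OF roots, of 1] assms by simp
  then have s2: "s\<^sub>2 < 1" using \<open>s\<^sub>1 < s\<^sub>2\<close> \<open>\<delta> < 2\<close> s by (auto simp: zero_less_mult_iff)
  have "s\<^sub>1\<^sup>2 < (\<delta> / 2)\<^sup>2" "(\<delta> / 2)\<^sup>2 < s\<^sub>2\<^sup>2"
    using s by (auto intro!: power_strict_mono)
  then have "encircles (level \<delta> c) {(0, sqrt (1 - (\<delta> / 2)\<^sup>2)), (0, - sqrt (1 - (\<delta> / 2)\<^sup>2))}"
    by (intro encircles_mirror_pair[where s\<^sub>1 = s\<^sub>1 and s\<^sub>2 = s\<^sub>2])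
      (use assms s s2 \<open>s\<^sub>1 < s\<^sub>2\<close> level_cos_at_root[OF roots] level_cos_between_roots[OF roots]
         level_outside_roots[OF roots] in auto)
  then show ?thesis
    using assms by (simp add: P_plus_def mirror_def power_divide)
qed

section \<open>Level sets that are graphs over the circle\<close>

text \<open>For c < 1 the two roots in s have the negative product c - 1, so each g has a unique
  positive root. The condition c > \<delta> keeps that root below 1 for every g, hence G away from 0
  and the two mirror graphs apart.\<close>

lemma level_defined_for_all_g:
  assumes "0 < \<delta>" "\<delta> < c" "c < 1"
  shows "defined_for_all_g (level \<delta> c)"
proof -
  define s where "s = (\<lambda>g. (\<delta> * cos g + sqrt ((\<delta> * cos g)\<^sup>2 + 4 * (1 - c))) / 2)"
  define \<phi> where "\<phi> = (\<lambda>g. sqrt (1 - (s g)\<^sup>2))"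
  have root: "1 - (s g)\<^sup>2 + \<delta> * s g * cos g = c" for g
  proof -
    have "0 \<le> (\<delta> * cos g)\<^sup>2 + 4 * (1 - c)" using assms by simp
    then have "(sqrt ((\<delta> * cos g)\<^sup>2 + 4 * (1 - c)))\<^sup>2 = (\<delta> * cos g)\<^sup>2 + 4 * (1 - c)" by simp
    then show ?thesis by (simp add: s_def power2_eq_square field_simps)
  qed
  have s_pos: "0 < s g" for g
  proof -
    have "\<bar>\<delta> * cos g\<bar> < sqrt ((\<delta> * cos g)\<^sup>2 + 4 * (1 - c))"
      using assms by (intro real_less_rsqrt) simp
    then show ?thesis by (simp add: s_def abs_less_iff)
  qed
  have s_less: "s g < 1" for g
  proof -
    have "\<delta> * cos g \<le> \<delta>" using assms by simp
    then have le: "\<delta> * cos g < c" "\<delta> * cos g \<le> 2" using assms by linarith+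
    \<comment> \<open>After squaring, this is just \<delta> cos g < c.\<close>
    have "sqrt ((\<delta> * cos g)\<^sup>2 + 4 * (1 - c)) < 2 - \<delta> * cos g"
      using assms le by (intro real_less_lsqrt) (auto simp: power2_eq_square algebra_simps)
    then show ?thesis by (simp add: s_def)
  qed
  have unique: "t = s g" if "0 \<le> t" "1 - t\<^sup>2 + \<delta> * t * cos g = c" for t g
  proof -
    have "(t - s g) * (t + s g - \<delta> * cos g) = 0"
      using root[of g] that(2) by (simp add: power2_eq_square algebra_simps)
    \<comment> \<open>The difference \<open>\<delta> * cos g - s g\<close> is the other root of the
      quadratic, which is negative; so the second factor of the product above cannot vanish.\<close>
    moreover have "0 < t + s g - \<delta> * cos g"
    proof -
      have "s g * (s g - \<delta> * cos g) = 1 - c" using root[of g] by (simp add: power2_eq_square algebra_simps)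
      then have "0 < s g * (s g - \<delta> * cos g)" using assms by simp
      then show ?thesis using that(1) s_pos[of g] by (simp add: zero_less_mult_iff)
    qed
    ultimately show ?thesis by simp
  qed
  have s_sq: "0 < (s g)\<^sup>2" "(s g)\<^sup>2 < 1" for g
    using s_pos[of g] s_less[of g] by (simp_all add: power_less_one_iff)
  have \<phi>: "0 < \<phi> g" "\<phi> g \<le> 1" "sqrt (1 - (\<phi> g)\<^sup>2) = s g" for g
    using s_sq[of g] s_pos[of g] by (auto simp: \<phi>_def)
  have "level \<delta> c = {(g, G). G = \<phi> g \<or> G = - \<phi> g}"
  proof (rule set_eqI, clarify)
    fix g G
    show "(g, G) \<in> level \<delta> c \<longleftrightarrow> (g, G) \<in> {(g, G). G = \<phi> g \<or> G = - \<phi> g}"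
    proof
      assume "(g, G) \<in> level \<delta> c"
      then have G: "G \<in> {-1..1}" "1 - (sqrt (1 - G\<^sup>2))\<^sup>2 + \<delta> * sqrt (1 - G\<^sup>2) * cos g = c"
        by (simp_all add: mem_level_iff)
      then have "sqrt (1 - G\<^sup>2) = s g" using unique sqrt_one_minus_sq by metis
      then have "\<bar>G\<bar> = \<phi> g"
        using G sqrt_one_minus_sq(3)[of G] by (simp add: \<phi>_def)
      then show "(g, G) \<in> {(g, G). G = \<phi> g \<or> G = - \<phi> g}" by auto
    next
      assume "(g, G) \<in> {(g, G). G = \<phi> g \<or> G = - \<phi> g}"
      then have "G = \<phi> g \<or> G = - \<phi> g" by simp
      then have "sqrt (1 - G\<^sup>2) = s g" "G \<in> {-1..1}" using \<phi>[of g] by auto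
      then show "(g, G) \<in> level \<delta> c" using root[of g] by (simp only: mem_level_iff)
    qed
  qed
  moreover have "continuous_on UNIV \<phi>"
    unfolding \<phi>_def s_def by (intro continuous_intros) auto
  moreover have "\<phi> (g + 2 * pi) = \<phi> g" for g by (simp add: \<phi>_def s_def)
  ultimately show ?thesis unfolding defined_for_all_g_def using \<phi>(1) by blast
qed

section \<open>Equilibria\<close>

lemma cos_diff_pi_eq_1_iff: "cos (g - pi) = 1 \<longleftrightarrow> cos g = (-1::real)"
  by (auto simp: cos_diff)

lemma F_ge:
  assumes "0 < \<delta>" "p \<in> strip"
  shows "- \<delta> \<le> F \<delta> p"
proof -
  obtain g G where p: "p = (g, G)" "G \<in> {-1..1}" using assms by (auto simp: strip_def)
  define s where "s = sqrt (1 - G\<^sup>2)"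
  have s: "0 \<le> s" "s \<le> 1" using sqrt_one_minus_sq[OF p(2)] by (simp_all add: s_def)
  have "\<delta> * s * (-1) \<le> \<delta> * s * cos g" using s assms by (intro mult_left_mono) auto
  moreover have "\<delta> * s \<le> \<delta> * 1" using s assms by (intro mult_left_mono) auto
  moreover have "s\<^sup>2 \<le> 1" using s by (simp add: power_le_one)
  ultimately show ?thesis using p F_eq[OF p(2), of \<delta> g, folded s_def] by simp
qed

lemma level_minimum:
  assumes "0 < \<delta>"
  shows "level \<delta> (- \<delta>) = lift {P_minus}"
proof (rule set_eqI, clarify)
  fix g G
  have "(g, G) \<in> level \<delta> (- \<delta>) \<longleftrightarrow> cos g = -1 \<and> G = 0"
  proof
    assume "(g, G) \<in> level \<delta> (- \<delta>)"
    then have G: "G \<in> {-1..1}" and eq: "1 - (sqrt (1 - G\<^sup>2))\<^sup>2 + \<delta> * sqrt (1 - G\<^sup>2) * cos g = - \<delta>"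
      by (simp_all add: mem_level_iff)
    define s where "s = sqrt (1 - G\<^sup>2)"
    have s: "0 \<le> s" "s \<le> 1" "s\<^sup>2 = 1 - G\<^sup>2" using sqrt_one_minus_sq[OF G] by (simp_all add: s_def)
    have "\<delta> * s * (-1) \<le> \<delta> * s * cos g" using s assms by (intro mult_left_mono) auto
    moreover have "\<delta> * s \<le> \<delta> * 1" using s assms by (intro mult_left_mono) auto
    ultimately have "1 - s\<^sup>2 \<le> 0" using eq unfolding s_def[symmetric] by linarith
    then have "G = 0" using s by simp
    then have "\<delta> * (cos g + 1) = 0" using eq by (simp add: algebra_simps)
    then show "cos g = -1 \<and> G = 0" using \<open>G = 0\<close> assms by simp
  qed (auto simp: mem_level_iff)
  then show "(g, G) \<in> level \<delta> (- \<delta>) \<longleftrightarrow> (g, G) \<in> lift {P_minus}"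
    by (simp add: P_minus_def mem_lift_insert cos_diff_pi_eq_1_iff)
qed

lemma F_le:
  assumes "0 < \<delta>" "p \<in> strip"
  shows "F \<delta> p \<le> 1 + \<delta>\<^sup>2 / 4"
proof -
  obtain g G where p: "p = (g, G)" "G \<in> {-1..1}" using assms by (auto simp: strip_def)
  define s where "s = sqrt (1 - G\<^sup>2)"
  have s: "0 \<le> s" using sqrt_one_minus_sq[OF p(2)] by (simp add: s_def)
  have "\<delta> * s * cos g \<le> \<delta> * s * 1" using s assms by (intro mult_left_mono) auto
  moreover have "0 \<le> (s - \<delta> / 2)\<^sup>2" by simp
  ultimately show ?thesis using p F_eq[OF p(2), of \<delta> g, folded s_def]
    by (simp add: power2_eq_square algebra_simps)
qed

lemma level_maximum:
  assumes "0 < \<delta>" "\<delta> \<le> 2"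
  shows "level \<delta> (1 + \<delta>\<^sup>2 / 4) = lift {P_plus \<delta>, mirror (P_plus \<delta>)}"
proof (rule set_eqI, clarify)
  fix g G
  have "\<delta>\<^sup>2 \<le> 2\<^sup>2" using assms by (intro power_mono) auto
  then have d4: "\<delta>\<^sup>2 \<le> 4" by simp
  have "(g, G) \<in> level \<delta> (1 + \<delta>\<^sup>2 / 4) \<longleftrightarrow> cos g = 1 \<and> \<bar>G\<bar> = sqrt (1 - \<delta>\<^sup>2 / 4)"
  proof
    assume "(g, G) \<in> level \<delta> (1 + \<delta>\<^sup>2 / 4)"
    then have G: "G \<in> {-1..1}"
      and eq: "1 - (sqrt (1 - G\<^sup>2))\<^sup>2 + \<delta> * sqrt (1 - G\<^sup>2) * cos g = 1 + \<delta>\<^sup>2 / 4"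
      by (simp_all add: mem_level_iff)
    define s where "s = sqrt (1 - G\<^sup>2)"
    have s: "0 \<le> s" "s\<^sup>2 = 1 - G\<^sup>2" using sqrt_one_minus_sq[OF G] by (simp_all add: s_def)
    have le: "0 \<le> \<delta> * s * (1 - cos g)" using s assms by (intro mult_nonneg_nonneg) auto
    \<comment> \<open>The gap between the value 1 + \<delta>^2 / 4 and \<open>F\<close>, split into
      two nonnegative terms: one forces s = \<delta> / 2, the other cos g = 1.\<close>
    have sum0: "(s - \<delta> / 2)\<^sup>2 + \<delta> * s * (1 - cos g) = 0"
      using eq[folded s_def] by (simp add: power2_eq_square algebra_simps)
    then have zero: "(s - \<delta> / 2)\<^sup>2 = 0" "\<delta> * s * (1 - cos g) = 0"
      using le zero_le_power2[of "s - \<delta> / 2"] by linarith+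
    then have "s = \<delta> / 2" by simp
    then have "cos g = 1" using zero(2) assms by simp
    moreover have "\<bar>G\<bar> = sqrt (1 - \<delta>\<^sup>2 / 4)"
    proof -
      have "s\<^sup>2 = \<delta>\<^sup>2 / 4" unfolding \<open>s = \<delta> / 2\<close> by (simp add: power_divide)
      then have "G\<^sup>2 = 1 - \<delta>\<^sup>2 / 4" using s(2) by linarith
      then show ?thesis by (metis real_sqrt_abs)
    qed
    ultimately show "cos g = 1 \<and> \<bar>G\<bar> = sqrt (1 - \<delta>\<^sup>2 / 4)" by simp
  next
    assume a: "cos g = 1 \<and> \<bar>G\<bar> = sqrt (1 - \<delta>\<^sup>2 / 4)"
    have "G\<^sup>2 = \<bar>G\<bar>\<^sup>2" by simp
    also have "\<dots> = 1 - \<delta>\<^sup>2 / 4" using a d4 by simp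
    finally have G2: "G\<^sup>2 = 1 - \<delta>\<^sup>2 / 4" .
    then have "1 - G\<^sup>2 = (\<delta> / 2)\<^sup>2" by (simp add: power_divide)
    then have s: "sqrt (1 - G\<^sup>2) = \<delta> / 2" using assms by simp
    have "\<bar>G\<bar> \<le> 1" using a by simp
    then have "G \<in> {-1..1}" by auto
    then show "(g, G) \<in> level \<delta> (1 + \<delta>\<^sup>2 / 4)"
      using a unfolding mem_level_iff s by (simp add: power2_eq_square)
  qed
  also have "\<dots> \<longleftrightarrow> (g, G) \<in> lift {P_plus \<delta>, mirror (P_plus \<delta>)}"
    using assms d4 by (auto simp: P_plus_def mirror_def mem_lift_insert abs_if)
  finally show "(g, G) \<in> level \<delta> (1 + \<delta>\<^sup>2 / 4) \<longleftrightarrow> (g, G) \<in> lift {P_plus \<delta>, mirror (P_plus \<delta>)}" .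
qed

text \<open>For \<delta> \<ge> 2 the vertex \<delta> / 2 of the parabola 1 - s^2 + \<delta> s is not
  below the range [0, 1] of s, so the largest value is taken at s = 1. The gap to it factors as (1 -
  s) (\<delta> - 1 - s).\<close>

lemma F_le_large:
  assumes "2 \<le> \<delta>" "p \<in> strip"
  shows "F \<delta> p \<le> \<delta>"
proof -
  obtain g G where p: "p = (g, G)" "G \<in> {-1..1}" using assms by (auto simp: strip_def)
  define s where "s = sqrt (1 - G\<^sup>2)"
  have s: "0 \<le> s" "s \<le> 1" using sqrt_one_minus_sq[OF p(2)] by (simp_all add: s_def)
  have "\<delta> * s * cos g \<le> \<delta> * s * 1" using s assms by (intro mult_left_mono) auto
  moreover have "0 \<le> (1 - s) * (\<delta> - 1 - s)" using s assms by (intro mult_nonneg_nonneg) auto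
  ultimately show ?thesis using p F_eq[OF p(2), of \<delta> g, folded s_def]
    by (simp add: power2_eq_square algebra_simps)
qed

lemma level_maximum_large:
  assumes "2 < \<delta>"
  shows "level \<delta> \<delta> = lift {(0, 0)}"
proof (rule set_eqI, clarify)
  fix g G
  have "(g, G) \<in> level \<delta> \<delta> \<longleftrightarrow> cos g = 1 \<and> G = 0"
  proof
    assume "(g, G) \<in> level \<delta> \<delta>"
    then have G: "G \<in> {-1..1}"
      and eq: "1 - (sqrt (1 - G\<^sup>2))\<^sup>2 + \<delta> * sqrt (1 - G\<^sup>2) * cos g = \<delta>"
      by (simp_all add: mem_level_iff)
    define s where "s = sqrt (1 - G\<^sup>2)"
    have s: "0 \<le> s" "s \<le> 1" "s\<^sup>2 = 1 - G\<^sup>2" using sqrt_one_minus_sq[OF G] by (simp_all add: s_def)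
    have le: "0 \<le> \<delta> * s * (1 - cos g)" "0 \<le> (1 - s) * (\<delta> - 1 - s)"
      using s assms by (auto intro!: mult_nonneg_nonneg)
    have sum0: "(1 - s) * (\<delta> - 1 - s) + \<delta> * s * (1 - cos g) = 0"
      using eq[folded s_def] by (simp add: power2_eq_square algebra_simps)
    then have "(1 - s) * (\<delta> - 1 - s) = 0" using le by linarith
    then have "s = 1" using s assms by auto
    then show "cos g = 1 \<and> G = 0" using sum0 assms s by simp
  qed (auto simp: mem_level_iff)
  then show "(g, G) \<in> level \<delta> \<delta> \<longleftrightarrow> (g, G) \<in> lift {(0, 0)}"
    by (simp add: mem_lift_insert)
qed

lemma P_minus_in_level: "P_minus \<in> level \<delta> (- \<delta>)"
  by (simp add: P_minus_def mem_level_iff)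

lemma P_zero_in_level: "P_zero \<in> level \<delta> \<delta>"
  by (simp add: P_zero_def mem_level_iff)

lemma mem_lift_self: "p \<in> S \<Longrightarrow> p \<in> lift S"
  by (cases p) (auto simp: mem_lift_iff intro!: exI[of _ 0])

lemma arg_min_eq_level:
  assumes "\<And>p. p \<in> strip \<Longrightarrow> m \<le> F \<delta> p" "level \<delta> m \<noteq> {}"
  shows "{p. is_arg_min (F \<delta>) (\<lambda>p. p \<in> strip) p} = level \<delta> m"
proof -
  obtain q where "q \<in> strip" "F \<delta> q = m" using assms(2) by (auto simp: level_def)
  then have "is_arg_min (F \<delta>) (\<lambda>p. p \<in> strip) p \<longleftrightarrow> p \<in> strip \<and> F \<delta> p = m" for p
    unfolding is_arg_min_def using assms(1) by (metis antisym leD not_less)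
  then show ?thesis by (simp add: level_def)
qed

lemma arg_max_eq_level:
  assumes "\<And>p. p \<in> strip \<Longrightarrow> F \<delta> p \<le> m" "level \<delta> m \<noteq> {}"
  shows "{p. is_arg_max (F \<delta>) (\<lambda>p. p \<in> strip) p} = level \<delta> m"
proof -
  obtain q where "q \<in> strip" "F \<delta> q = m" using assms(2) by (auto simp: level_def)
  then have "is_arg_max (F \<delta>) (\<lambda>p. p \<in> strip) p \<longleftrightarrow> p \<in> strip \<and> F \<delta> p = m" for p
    unfolding is_arg_max_def using assms(1) by (metis antisym leD not_less)
  then show ?thesis by (simp add: level_def)
qed

text \<open>Once both extreme values are attained, the intermediate value theorem on the connected
  strip supplies all values in between.\<close>

lemma level_nonempty_iff:
  assumes "\<And>p. p \<in> strip \<Longrightarrow> m \<le> F \<delta> p" "\<And>p. p \<in> strip \<Longrightarrow> F \<delta> p \<le> M"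
    and "level \<delta> m \<noteq> {}" "level \<delta> M \<noteq> {}"
  shows "level \<delta> c \<noteq> {} \<longleftrightarrow> c \<in> {m..M}"
proof
  assume "c \<in> {m..M}"
  have "connected strip"
    unfolding strip_def by (intro connected_Times) auto
  moreover have "continuous_on strip (F \<delta>)"
    unfolding F_def case_prod_unfold by (intro continuous_intros)
  ultimately have "connected (F \<delta> ` strip)" by (rule connected_continuous_image[rotated])
  moreover have "m \<in> F \<delta> ` strip" "M \<in> F \<delta> ` strip" using assms(3,4) by (auto simp: level_def)
  ultimately have "c \<in> F \<delta> ` strip" using \<open>c \<in> {m..M}\<close> by (auto dest: connectedD_interval)
  then show "level \<delta> c \<noteq> {}" by (auto simp: level_def)
qed (use assms in \<open>auto simp: level_def\<close>)

section \<open>Critical points in the interior and on the boundary of the strip\<close>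

definition F' :: "real \<Rightarrow> real \<times> real \<Rightarrow> real \<times> real \<Rightarrow> real" where
  "F' \<delta> p v = - \<delta> * sqrt (1 - (snd p)\<^sup>2) * sin (fst p) * fst v +
     (2 * snd p - \<delta> * snd p * cos (fst p) / sqrt (1 - (snd p)\<^sup>2)) * snd v"

lemma interior_strip: "interior strip = UNIV \<times> {-1<..<1}"
  by (simp add: strip_def interior_Times)

lemma F_has_derivative:
  assumes "p \<in> interior strip"
  shows "(F \<delta> has_derivative F' \<delta> p) (at p)"
proof -
  have "0 < 1 - (snd p)\<^sup>2"
    using assms by (auto simp: interior_strip abs_square_less_1)
  then show ?thesis
    unfolding F_def F'_def case_prod_unfold
    by (auto intro!: derivative_eq_intros simp: field_simps fun_eq_iff)
qed

text \<open>Move inwards from the boundary by t and put u = t (2 - t), k = \<delta> cos g. Then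
  \<open>F\<close> changes by k sqrt u - u. If k is not 0, the square root gives an infinite slope;
  if k = 0, the term -u still gives a nonzero slope. Either way the one-sided derivative cannot be
  0.\<close>

lemma not_equilibrium_boundary:
  assumes "\<bar>G\<bar> = 1"
  shows "\<not> equilibrium (F \<delta>) (g, G)"
proof
  assume "equilibrium (F \<delta>) (g, G)"
  then have "\<forall>e>0. \<exists>d>0. \<forall>y\<in>strip. norm (y - (g, G)) < d \<longrightarrow>
      norm (F \<delta> y - F \<delta> (g, G) - 0) \<le> e * norm (y - (g, G))"
    unfolding equilibrium_def has_derivative_within_alt by blast
  then obtain d where d: "0 < d" and *: "\<And>y. y \<in> strip \<Longrightarrow> norm (y - (g, G)) < d \<Longrightarrow>
      norm (F \<delta> y - F \<delta> (g, G) - 0) \<le> 1/2 * norm (y - (g, G))"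
    by (metis half_gt_zero zero_less_one)
  define k where "k = \<delta> * cos g"
  have G2: "G\<^sup>2 = 1" using assms by (simp add: abs_square_eq_1)
  \<comment> \<open>Tolerance 1/2 in the derivative gives at most t / 2 \<le> u / 2 for the change
    of \<open>F\<close>; dividing by sqrt u pins k between two multiples of sqrt u. The lower bound
    makes k positive, and the upper one fails as u tends to 0.\<close>
  have near: "sqrt u / 2 \<le> k \<and> k \<le> 3/2 * sqrt u" if t: "0 < t" "t < d" "t \<le> 1" "u = t * (2 - t)" for t u
  proof -
    have u: "0 < u" "t \<le> u" using t by (auto intro: mult_left_mono[of 1 "2 - t" t, simplified])
    have "\<bar>G * (1 - t)\<bar> \<le> 1" using assms t by (simp add: abs_mult)
    then have "(g, G * (1 - t)) \<in> strip" by (auto simp: strip_def)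
    moreover have "(g, G * (1 - t)) - (g, G) = (0, - G * t)" by (simp add: algebra_simps)
    moreover have "norm (0::real, - G * t) = t" using assms t by (simp add: norm_Pair abs_mult)
    ultimately have "\<bar>F \<delta> (g, G * (1 - t)) - F \<delta> (g, G)\<bar> \<le> 1/2 * t"
      using * t by (metis diff_zero real_norm_def)
    moreover have "(G * (1 - t))\<^sup>2 = 1 - u"
    proof -
      have "(G * (1 - t))\<^sup>2 = (1 - t)\<^sup>2" by (simp add: power_mult_distrib G2)
      then show ?thesis using t by (simp add: power2_eq_square algebra_simps)
    qed
    then have "F \<delta> (g, G * (1 - t)) = 1 - u + k * sqrt u"
      by (simp only: F_def case_prod_conv) (simp add: k_def)
    moreover have "F \<delta> (g, G) = 1" using G2 by (simp add: F_def)
    ultimately have "\<bar>k * sqrt u - u\<bar> \<le> 1/2 * u"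
      using u by simp
    then have "\<bar>k * sqrt u - sqrt u * sqrt u\<bar> \<le> 1/2 * (sqrt u * sqrt u)" using u by simp
    moreover have "\<bar>k * sqrt u - sqrt u * sqrt u\<bar> = \<bar>k - sqrt u\<bar> * sqrt u"
      using u by (simp only: left_diff_distrib[symmetric] abs_mult) simp
    ultimately have "\<bar>k - sqrt u\<bar> * sqrt u \<le> 1/2 * sqrt u * sqrt u"
      by (simp only: mult.assoc)
    then have "\<bar>k - sqrt u\<bar> \<le> 1/2 * sqrt u" using u by (simp only: mult_le_cancel_right) simp
    then show ?thesis by linarith
  qed
  define t where "t = min 1 (d / 2)"
  have t: "0 < t" "t < d" "t \<le> 1" using d by (auto simp: t_def)
  then have "0 < sqrt (t * (2 - t))" by simp
  then have "0 < k" using near[OF t refl] by linarith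
  \<comment> \<open>With t' \<le> k^2 / 9 one gets u \<le> 2 k^2 / 9 < (2 k / 3)^2, which violates k
    \<le> 3/2 sqrt u.\<close>
  define t' where "t' = min t (k\<^sup>2 / 9)"
  have t': "0 < t'" "t' < d" "t' \<le> 1" using t \<open>0 < k\<close> by (auto simp: t'_def)
  have "t' * (2 - t') \<le> t' * 2" using t' by (intro mult_left_mono) auto
  also have "\<dots> \<le> 2 * k\<^sup>2 / 9" by (simp add: t'_def)
  also have "\<dots> < (2/3 * k)\<^sup>2" using \<open>0 < k\<close> by (simp add: power_mult_distrib power_divide)
  finally have "sqrt (t' * (2 - t')) < 2/3 * k" using \<open>0 < k\<close> by (intro real_less_lsqrt) auto
  then show False using near[OF t' refl] by linarith
qed

lemma equilibrium_iff:
  "equilibrium (F \<delta>) (g, G) \<longleftrightarrow>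
     \<bar>G\<bar> < 1 \<and> \<delta> * sin g = 0 \<and> G * (2 * sqrt (1 - G\<^sup>2) - \<delta> * cos g) = 0"
proof (cases "\<bar>G\<bar> < 1")
  case True
  define s where "s = sqrt (1 - G\<^sup>2)"
  have s: "0 < s" using True by (simp add: s_def abs_square_less_1)
  have int: "(g, G) \<in> interior strip" using True by (auto simp: interior_strip)
  then have "at (g, G) within strip = at (g, G)" by (rule at_within_interior)
  moreover have "(g, G) \<in> strip" using int interior_subset by blast
  ultimately have "equilibrium (F \<delta>) (g, G) \<longleftrightarrow> (F \<delta> has_derivative (\<lambda>_. 0)) (at (g, G))"
    by (simp add: equilibrium_def)
  also have "\<dots> \<longleftrightarrow> F' \<delta> (g, G) = (\<lambda>_. 0)"
    using F_has_derivative[OF int] has_derivative_unique by metis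
  also have "\<dots> \<longleftrightarrow> F' \<delta> (g, G) (1, 0) = 0 \<and> F' \<delta> (g, G) (0, 1) = 0"
  proof -
    have "F' \<delta> (g, G) v = F' \<delta> (g, G) (1, 0) * fst v + F' \<delta> (g, G) (0, 1) * snd v" for v
      by (simp add: F'_def)
    then show ?thesis by (metis add_0 mult_zero_left)
  qed
  also have "\<dots> \<longleftrightarrow> \<delta> * sin g = 0 \<and> G * (2 * s - \<delta> * cos g) = 0"
    using s by (simp add: F'_def field_simps flip: s_def)
  finally show ?thesis using True by (simp add: s_def)
next
  case False
  have "\<not> equilibrium (F \<delta>) (g, G)"
  proof (cases "\<bar>G\<bar> = 1")
    case False
    then show ?thesis using \<open>\<not> \<bar>G\<bar> < 1\<close> by (auto simp: equilibrium_def strip_def)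
  qed (rule not_equilibrium_boundary)
  then show ?thesis using False by simp
qed

lemma sin_eq_0_iff_cos: "sin g = 0 \<longleftrightarrow> cos g = 1 \<or> cos g = (-1::real)"
proof -
  have "sin g = 0 \<longleftrightarrow> (sin g)\<^sup>2 = 0" by simp
  also have "\<dots> \<longleftrightarrow> (cos g)\<^sup>2 = 1" by (auto simp: sin_squared_eq)
  finally show ?thesis by (simp add: power2_eq_1_iff)
qed

text \<open>Since sin g = 0 forces cos g to be 1 or -1, an equilibrium with nonzero G has 2 s equal
  to \<delta> or -\<delta>; the negative value is impossible because s \<ge> 0.\<close>

lemma equilibrium_iff_cos:
  assumes "0 < \<delta>"
  shows "equilibrium (F \<delta>) (g, G) \<longleftrightarrow>
    (cos g = 1 \<or> cos g = -1) \<and> G = 0 \<or> cos g = 1 \<and> \<bar>G\<bar> < 1 \<and> 2 * sqrt (1 - G\<^sup>2) = \<delta>"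
proof -
  have "2 * sqrt (1 - G\<^sup>2) \<noteq> - \<delta>" if "\<bar>G\<bar> < 1"
  proof -
    have "G \<in> {-1..1}" using that by auto
    from sqrt_one_minus_sq(1)[OF this] show ?thesis using assms by linarith
  qed
  moreover have "equilibrium (F \<delta>) (g, G) \<longleftrightarrow> \<bar>G\<bar> < 1 \<and> (cos g = 1 \<or> cos g = -1) \<and>
      (G = 0 \<or> 2 * sqrt (1 - G\<^sup>2) = \<delta> * cos g)"
    using assms unfolding equilibrium_iff sin_eq_0_iff_cos[symmetric] by simp
  moreover have "\<bar>0\<bar> < (1::real)" by simp
  ultimately show ?thesis
    by (metis mult.right_neutral mult_minus1_right)
qed

lemma equilibria_small:
  assumes "0 < \<delta>" "\<delta> < 2"
  shows "{p. equilibrium (F \<delta>) p} = lift {P_minus, P_zero, P_plus \<delta>, mirror (P_plus \<delta>)}"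
proof (rule set_eqI, clarify)
  fix g G
  have "\<delta>\<^sup>2 < 2\<^sup>2" using assms by (intro power_strict_mono) auto
  then have d4: "\<delta>\<^sup>2 < 4" by simp
  have *: "\<bar>G\<bar> < 1 \<and> 2 * sqrt (1 - G\<^sup>2) = \<delta> \<longleftrightarrow> G = sqrt (1 - \<delta>\<^sup>2 / 4) \<or> G = - sqrt (1 - \<delta>\<^sup>2 / 4)"
  proof
    assume a: "\<bar>G\<bar> < 1 \<and> 2 * sqrt (1 - G\<^sup>2) = \<delta>"
    then have "G\<^sup>2 < 1" by (simp add: abs_square_less_1)
    then have "(sqrt (1 - G\<^sup>2))\<^sup>2 = 1 - G\<^sup>2" by simp
    moreover have "sqrt (1 - G\<^sup>2) = \<delta> / 2" using a by simp
    ultimately have "(\<delta> / 2)\<^sup>2 = 1 - G\<^sup>2" by metis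
    moreover have "\<delta>\<^sup>2 / 4 = (\<delta> / 2)\<^sup>2" by (simp add: power_divide)
    ultimately have "1 - \<delta>\<^sup>2 / 4 = G\<^sup>2" by linarith
    then have "sqrt (1 - \<delta>\<^sup>2 / 4) = \<bar>G\<bar>" by simp
    then show "G = sqrt (1 - \<delta>\<^sup>2 / 4) \<or> G = - sqrt (1 - \<delta>\<^sup>2 / 4)" by auto
  next
    assume a: "G = sqrt (1 - \<delta>\<^sup>2 / 4) \<or> G = - sqrt (1 - \<delta>\<^sup>2 / 4)"
    then have "1 - G\<^sup>2 = (\<delta> / 2)\<^sup>2" using d4 by (auto simp: power_divide)
    then have "sqrt (1 - G\<^sup>2) = \<delta> / 2" using assms by simp
    moreover have "\<bar>G\<bar> < 1" using a assms d4 by auto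
    ultimately show "\<bar>G\<bar> < 1 \<and> 2 * sqrt (1 - G\<^sup>2) = \<delta>" by simp
  qed
  have "P_plus \<delta> = (0, sqrt (1 - \<delta>\<^sup>2 / 4))" "mirror (P_plus \<delta>) = (0, - sqrt (1 - \<delta>\<^sup>2 / 4))"
    using assms by (simp_all add: P_plus_def mirror_def)
  then have "(g, G) \<in> lift {P_minus, P_zero, P_plus \<delta>, mirror (P_plus \<delta>)} \<longleftrightarrow>
      cos g = -1 \<and> G = 0 \<or> cos g = 1 \<and> G = 0 \<or>
      cos g = 1 \<and> (G = sqrt (1 - \<delta>\<^sup>2 / 4) \<or> G = - sqrt (1 - \<delta>\<^sup>2 / 4))"
    unfolding P_minus_def P_zero_def by (simp only: mem_lift_insert cos_diff_pi_eq_1_iff lift_empty) auto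
  also have "\<dots> \<longleftrightarrow> equilibrium (F \<delta>) (g, G)"
    unfolding equilibrium_iff_cos[OF assms(1)] *[symmetric] by blast
  finally show "(g, G) \<in> {p. equilibrium (F \<delta>) p} \<longleftrightarrow>
      (g, G) \<in> lift {P_minus, P_zero, P_plus \<delta>, mirror (P_plus \<delta>)}" by simp
qed

lemma equilibria_large:
  assumes "2 < \<delta>"
  shows "{p. equilibrium (F \<delta>) p} = lift {P_minus, P_plus \<delta>}"
proof (rule set_eqI, clarify)
  fix g G
  have "2 * sqrt (1 - G\<^sup>2) \<noteq> \<delta>" if "\<bar>G\<bar> < 1"
  proof -
    have "G \<in> {-1..1}" using that by auto
    from sqrt_one_minus_sq(2)[OF this] show ?thesis using assms by linarith
  qed
  then have "equilibrium (F \<delta>) (g, G) \<longleftrightarrow> (cos g = -1 \<or> cos g = 1) \<and> G = 0"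
    using equilibrium_iff_cos[of \<delta> g G] assms by auto
  also have "\<dots> \<longleftrightarrow> (g, G) \<in> lift {P_minus, P_plus \<delta>}"
    using assms by (auto simp: P_minus_def P_plus_def mem_lift_insert cos_diff_pi_eq_1_iff)
  finally show "(g, G) \<in> {p. equilibrium (F \<delta>) p} \<longleftrightarrow> (g, G) \<in> lift {P_minus, P_plus \<delta>}"
    by simp
qed

section \<open>Saddles\<close>

text \<open>The directional derivative along u vanishes at p and has positive rate of change there,
  so it is positive shortly after p; the mean value theorem then makes f increase along that
  segment. The derivatives are left arbitrary because \<open>saddle\<close> only asserts that some
  exist.\<close>

lemma increases_along_positive_second_derivative:
  fixes f :: "'a::real_normed_vector \<Rightarrow> real"
  assumes "open S" "p \<in> S"
    and f': "\<forall>\<^sub>F x in nhds p. (f has_derivative f' x) (at x)" "f' p u = 0"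
    and h: "((\<lambda>x. f' x u) has_derivative h) (at p)" "0 < h u"
  shows "\<exists>q\<in>S. f p < f q"
proof -
  have "\<forall>\<^sub>F x in nhds p. x \<in> S \<and> (f has_derivative f' x) (at x)"
    using f'(1) eventually_nhds_in_open[OF assms(1,2)] by eventually_elim simp
  then obtain e where e: "0 < e" and
    near: "\<And>x. dist x p < e \<Longrightarrow> x \<in> S \<and> (f has_derivative f' x) (at x)"
    by (auto simp: eventually_nhds_metric)
  define \<psi> where "\<psi> = (\<lambda>t. f' (p + t *\<^sub>R u) u)"
  interpret h: bounded_linear h using h(1) by (rule has_derivative_bounded_linear)
  have "((\<lambda>t. p + t *\<^sub>R u) has_derivative (\<lambda>t. t *\<^sub>R u)) (at (0::real))"
    by (auto intro!: derivative_eq_intros)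
  moreover have "((\<lambda>x. f' x u) has_derivative h) (at (p + 0 *\<^sub>R u))" using h(1) by simp
  ultimately have "(\<psi> has_derivative (\<lambda>t. h (t *\<^sub>R u))) (at 0)"
    unfolding \<psi>_def by (rule has_derivative_compose)
  then have "(\<psi> has_real_derivative h u) (at 0)"
    by (simp add: has_field_derivative_def h.scaleR mult.commute[of _ "h u"])
  from DERIV_pos_inc_right[OF this h(2)] obtain d where d: "0 < d"
    and \<psi>: "\<And>t. 0 < t \<Longrightarrow> t < d \<Longrightarrow> \<psi> 0 < \<psi> (0 + t)" by blast
  have \<psi>0: "\<psi> 0 = 0" using f'(2) by (simp add: \<psi>_def)
  \<comment> \<open>The first bound keeps the directional derivative positive, the second keeps the
    segment in the ball of radius e. The summand 1 rules out a zero denominator.\<close>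
  define r where "r = min (d / 2) (e / (2 * (norm u + 1)))"
  have r: "0 < r" "r < d" using d e by (auto simp: r_def add_nonneg_pos)
  have "r * norm u \<le> e / (2 * (norm u + 1)) * norm u"
    by (intro mult_right_mono) (auto simp: r_def)
  also have "\<dots> < e"
  proof -
    have "norm u < 2 * (norm u + 1)" unfolding distrib_left using norm_ge_zero[of u] by linarith
    then have "norm u / (2 * (norm u + 1)) < 1" by (simp add: divide_less_eq_1 add_nonneg_pos)
    from mult_strict_left_mono[OF this e] show ?thesis by simp
  qed
  finally have re: "r * norm u < e" .
  have inb: "dist (p + t *\<^sub>R u) p < e" if "0 \<le> t" "t \<le> r" for t
  proof -
    have "t * norm u \<le> r * norm u" using that by (intro mult_right_mono) auto
    then show ?thesis using re that by (simp add: dist_norm)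
  qed
  have "((\<lambda>t. f (p + t *\<^sub>R u)) has_real_derivative \<psi> t) (at t)" if "0 \<le> t" "t \<le> r" for t
  proof -
    interpret f': bounded_linear "f' (p + t *\<^sub>R u)"
      using near[OF inb[OF that]] by (auto intro: has_derivative_bounded_linear)
    have "((\<lambda>t. p + t *\<^sub>R u) has_derivative (\<lambda>t. t *\<^sub>R u)) (at t)"
      by (auto intro!: derivative_eq_intros)
    then have "((\<lambda>t. f (p + t *\<^sub>R u)) has_derivative (\<lambda>s. f' (p + t *\<^sub>R u) (s *\<^sub>R u))) (at t)"
      by (rule has_derivative_compose) (use near[OF inb[OF that]] in simp)
    then show ?thesis
      by (simp add: has_field_derivative_def f'.scaleR \<psi>_def mult.commute[of _ "f' (p + t *\<^sub>R u) u"])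
  qed
  from MVT2[OF r(1) this] obtain z where "0 < z" "z < r"
    and "f (p + r *\<^sub>R u) - f (p + 0 *\<^sub>R u) = (r - 0) * \<psi> z" by blast
  moreover have "0 < \<psi> z" using \<psi>[of z] \<psi>0 \<open>0 < z\<close> \<open>z < r\<close> r by simp
  ultimately have "f p < f (p + r *\<^sub>R u)" using r by (simp add: algebra_simps)
  then show ?thesis using near[OF inb[of r]] r by auto
qed

text \<open>The second-order argument is applied to f in a direction where the Hessian is positive,
  and to -f in a direction where it is negative.\<close>

lemma saddle_not_extremal:
  assumes "saddle f p"
  shows "\<exists>q\<in>strip. f p < f q" "\<exists>q\<in>strip. f q < f p"
proof -
  from assms obtain f' H u v where p: "p \<in> interior strip"
    and f': "\<forall>\<^sub>F x in nhds p. (f has_derivative f' x) (at x)" "f' p = (\<lambda>_. 0)"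
    and H: "\<And>v. ((\<lambda>x. f' x v) has_derivative (\<lambda>u. H u v)) (at p)"
    and u: "H u u > 0" and v: "H v v < 0"
    unfolding saddle_def by blast
  have "\<exists>q\<in>interior strip. f p < f q"
    by (rule increases_along_positive_second_derivative[OF open_interior p f'(1) _ H u]) (simp add: f'(2))
  then show "\<exists>q\<in>strip. f p < f q" using interior_subset by blast
  have "\<exists>q\<in>interior strip. - f p < - f q"
  proof (rule increases_along_positive_second_derivative[OF open_interior p])
    show "\<forall>\<^sub>F x in nhds p. ((\<lambda>x. - f x) has_derivative (\<lambda>w. - f' x w)) (at x)"
      using f'(1) by eventually_elim (rule has_derivative_minus)
    show "((\<lambda>x. - f' x v) has_derivative (\<lambda>w. - H w v)) (at p)"
      by (rule has_derivative_minus[OF H])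
  qed (use f' v in auto)
  then show "\<exists>q\<in>strip. f q < f p" using interior_subset by auto
qed

lemma saddle_imp_equilibrium:
  assumes "saddle f p"
  shows "equilibrium f p"
proof -
  have "(f has_derivative (\<lambda>_. 0)) (at p)" "p \<in> strip"
    using assms eventually_nhds_x_imp_x interior_subset unfolding saddle_def by force+
  then show ?thesis by (simp add: equilibrium_def has_derivative_at_withinI)
qed

lemma saddle_not_in_extremal_level:
  assumes "saddle (F \<delta>) p"
    and "(\<forall>q\<in>strip. m \<le> F \<delta> q) \<or> (\<forall>q\<in>strip. F \<delta> q \<le> m)"
  shows "p \<notin> level \<delta> m"
proof
  assume "p \<in> level \<delta> m"
  then have "F \<delta> p = m" by (simp add: level_def)
  then show False using saddle_not_extremal[OF assms(1)] assms(2) by (metis not_less)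
qed

lemma saddle_lift_P_zero:
  assumes "0 < \<delta>" "\<delta> < 2" "p \<in> lift {P_zero}"
  shows "saddle (F \<delta>) p"
proof -
  from assms(3) obtain g where p: "p = (g, 0)" "cos g = 1"
    by (cases p) (auto simp: P_zero_def mem_lift_insert)
  then have sin0: "sin g = 0" by (simp add: sin_eq_0_iff_cos)
  have int: "p \<in> interior strip" by (simp add: p interior_strip)
  \<comment> \<open>The Hessian at the origin is diagonal with entries -\<delta> and 2 - \<delta>,
    because \<open>F\<close> is \<delta> - \<delta> g^2 / 2 + (1 - \<delta> / 2) G^2 to second
    order. It is indefinite exactly for 0 < \<delta> < 2 when \<delta> > 0.\<close>
  define H where "H = (\<lambda>u v::real \<times> real. - \<delta> * fst u * fst v + (2 - \<delta>) * snd u * snd v)"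
  have "\<forall>\<^sub>F x in nhds p. (F \<delta> has_derivative F' \<delta> x) (at x)"
    using eventually_nhds_in_open[OF open_interior int] by eventually_elim (rule F_has_derivative)
  moreover have "F' \<delta> p = (\<lambda>_. 0)" by (simp add: F'_def p sin0 fun_eq_iff)
  moreover have "((\<lambda>x. F' \<delta> x v) has_derivative (\<lambda>u. H u v)) (at p)" for v
    unfolding F'_def H_def p
    by (auto intro!: derivative_eq_intros simp: p sin0 fun_eq_iff algebra_simps)
  moreover have "0 < H (0, 1) (0, 1)" "H (1, 0) (1, 0) < 0" using assms by (simp_all add: H_def)
  ultimately show ?thesis unfolding saddle_def using int by blast
qed

lemma lift_Un: "lift (S \<union> T) = lift S \<union> lift T"
  unfolding lift_def by blast

lemma saddles_small:
  assumes "0 < \<delta>" "\<delta> < 2"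
  shows "{p. saddle (F \<delta>) p} = lift {P_zero}"
proof
  show "{p. saddle (F \<delta>) p} \<subseteq> lift {P_zero}"
  proof clarify
    fix g G assume s: "saddle (F \<delta>) (g, G)"
    then have "(g, G) \<in> lift {P_minus, P_zero, P_plus \<delta>, mirror (P_plus \<delta>)}"
      using saddle_imp_equilibrium equilibria_small[OF assms] by blast
    moreover have "(g, G) \<notin> lift {P_minus}"
      using saddle_not_in_extremal_level[OF s, of "- \<delta>"] F_ge level_minimum assms by blast
    moreover have "(g, G) \<notin> lift {P_plus \<delta>, mirror (P_plus \<delta>)}"
      using saddle_not_in_extremal_level[OF s, of "1 + \<delta>\<^sup>2 / 4"] F_le
        level_maximum[OF assms(1) less_imp_le[OF assms(2)]] assms by blast
    moreover have "lift {P_minus, P_zero, P_plus \<delta>, mirror (P_plus \<delta>)} =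
        lift {P_minus} \<union> lift {P_zero} \<union> lift {P_plus \<delta>, mirror (P_plus \<delta>)}"
      unfolding lift_Un[symmetric] by (rule arg_cong[where f = lift]) auto
    ultimately show "(g, G) \<in> lift {P_zero}" by blast
  qed
qed (use saddle_lift_P_zero[OF assms] in blast)

lemma saddles_large:
  assumes "2 < \<delta>"
  shows "{p. saddle (F \<delta>) p} = {}"
proof -
  have "\<not> saddle (F \<delta>) p" for p
  proof
    assume s: "saddle (F \<delta>) p"
    then have "p \<in> lift {P_minus, P_plus \<delta>}"
      using saddle_imp_equilibrium equilibria_large[OF assms] by blast
    moreover have "p \<notin> lift {P_minus}"
      using saddle_not_in_extremal_level[OF s, of "- \<delta>"] F_ge level_minimum[of \<delta>] assms by fastforce
    moreover have "p \<notin> lift {P_plus \<delta>}"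
      using saddle_not_in_extremal_level[OF s, of \<delta>] F_le_large[of \<delta>] level_maximum_large[OF assms] assms
      by (simp add: P_plus_def)
    moreover have "lift {P_minus, P_plus \<delta>} = lift {P_minus} \<union> lift {P_plus \<delta>}"
      unfolding lift_Un[symmetric] by (rule arg_cong[where f = lift]) auto
    ultimately show False by blast
  qed
  then show ?thesis by simp
qed

section \<open>The vertical branch\<close>

lemma mem_vertical_branchI:
  assumes "1 - \<delta>\<^sup>2 * (cos g)\<^sup>2 = G\<^sup>2" "0 \<le> cos g"
  shows "(g, G) \<in> vertical_branch \<delta>"
proof -
  have "\<delta>\<^sup>2 * (cos g)\<^sup>2 \<le> 1" using assms(1) zero_le_power2[of G] by linarith
  then show ?thesis
    using assms by (auto simp: vertical_branch_def vertical_curve_def vert_def abs_if)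
qed

text \<open>At c = 1 the constant term disappears and the level equation factors as s (\<delta> cos
  g - s) = 0. The factor s gives the horizontal branch; the other factor gives the vertical one
  together with its sign condition on cos g.\<close>

lemma S1_eq:
  assumes "0 \<le> \<delta>"
  shows "S1 \<delta> = horizontal_branch \<union> vertical_branch \<delta>"
proof (rule set_eqI, clarify)
  fix g G
  show "(g, G) \<in> S1 \<delta> \<longleftrightarrow> (g, G) \<in> horizontal_branch \<union> vertical_branch \<delta>"
  proof
    assume "(g, G) \<in> S1 \<delta>"
    then have G: "G \<in> {-1..1}" and eq: "1 - (sqrt (1 - G\<^sup>2))\<^sup>2 + \<delta> * sqrt (1 - G\<^sup>2) * cos g = 1"
      by (simp_all add: S1_def mem_level_iff)
    define s where "s = sqrt (1 - G\<^sup>2)"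
    have s: "0 \<le> s" "s\<^sup>2 = 1 - G\<^sup>2" using sqrt_one_minus_sq[OF G] by (simp_all add: s_def)
    have "s * (\<delta> * cos g - s) = 0"
      using eq[folded s_def] by (simp add: power2_eq_square algebra_simps)
    then consider "s = 0" | "0 < s" "s = \<delta> * cos g" using s by fastforce
    then show "(g, G) \<in> horizontal_branch \<union> vertical_branch \<delta>"
    proof cases
      case 1
      then have "G\<^sup>2 = 1" using s by simp
      then show ?thesis by (auto simp: horizontal_branch_def power2_eq_1_iff)
    next
      case 2
      then have "0 \<le> cos g" using assms by (metis mult_nonneg_nonpos linear not_less)
      moreover have "1 - \<delta>\<^sup>2 * (cos g)\<^sup>2 = G\<^sup>2" using 2 s by (simp add: power_mult_distrib)
      ultimately show ?thesis by (blast intro: mem_vertical_branchI)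
    qed
  next
    assume "(g, G) \<in> horizontal_branch \<union> vertical_branch \<delta>"
    then consider "G\<^sup>2 = 1" | "0 \<le> cos g" "0 \<le> 1 - \<delta>\<^sup>2 * (cos g)\<^sup>2" "G\<^sup>2 = 1 - \<delta>\<^sup>2 * (cos g)\<^sup>2"
      by (auto simp: horizontal_branch_def vertical_branch_def vertical_curve_def vert_def)
    then show "(g, G) \<in> S1 \<delta>"
    proof cases
      case 1
      then show ?thesis by (auto simp: S1_def mem_level_iff power2_eq_1_iff)
    next
      case 2
      then have "1 - G\<^sup>2 = (\<delta> * cos g)\<^sup>2" by (simp add: power_mult_distrib)
      then have "sqrt (1 - G\<^sup>2) = \<delta> * cos g" using assms 2 by simp
      moreover have "\<bar>G\<bar> \<le> 1" using 2 by (simp add: abs_square_le_1[symmetric])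
      ultimately show ?thesis
        by (auto simp: S1_def mem_level_iff power2_eq_square)
    qed
  qed
qed

section \<open>Smooth gluing of the two branches\<close>

text \<open>Agreement of values and of first derivatives at the junction is all that is required,
  since the two closed half lines meet only there.\<close>

lemma C1_differentiable_glue:
  fixes f k f' k' :: "real \<Rightarrow> real"
  assumes f: "\<And>y. y \<in> I \<Longrightarrow> (f has_real_derivative f' y) (at y)" "continuous_on I f'"
    and k: "\<And>y. y \<in> I \<Longrightarrow> (k has_real_derivative k' y) (at y)" "continuous_on I k'"
    and x: "x \<in> I" "f x = k x" "f' x = k' x"
  shows "(\<lambda>y. if y \<le> x then f y else k y) C1_differentiable_on I"
  unfolding C1_differentiable_on_def
proof (intro exI conjI ballI)
  fix y assume y: "y \<in> I"
  have cl: "closure {..x} \<inter> closure {x<..} = {x}" by auto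
  have "((\<lambda>y. if y \<in> {..x} then f y else k y) has_vector_derivative
      (if y \<in> {..x} then f' y else k' y)) (at y within UNIV)"
    using f(1)[OF y] k(1)[OF y] f(1)[OF x(1)] k(1)[OF x(1)] x
    by (intro has_vector_derivative_If_within_closures[where T = "{x<..}"])
       (auto simp: cl has_real_derivative_iff_has_vector_derivative
             intro: has_vector_derivative_at_within)
  then show "((\<lambda>y. if y \<le> x then f y else k y) has_vector_derivative
      (if y \<le> x then f' y else k' y)) (at y)" by simp
next
  have "continuous_on ({y\<in>I. y \<le> x} \<union> {y\<in>I. x \<le> y}) (\<lambda>y. if y \<le> x then f' y else k' y)"
  proof (rule continuous_on_cases_local)
    show "closedin (top_of_set ({y\<in>I. y \<le> x} \<union> {y\<in>I. x \<le> y})) {y\<in>I. y \<le> x}"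
      by (rule closedin_closed[THEN iffD2]) (auto intro!: exI[of _ "{..x}"])
    show "closedin (top_of_set ({y\<in>I. y \<le> x} \<union> {y\<in>I. x \<le> y})) {y\<in>I. x \<le> y}"
      by (rule closedin_closed[THEN iffD2]) (auto intro!: exI[of _ "{x..}"])
  qed (use x in \<open>auto intro: continuous_on_subset[OF f(2)] continuous_on_subset[OF k(2)]\<close>)
  moreover have "{y\<in>I. y \<le> x} \<union> {y\<in>I. x \<le> y} = I" by auto
  ultimately show "continuous_on I (\<lambda>y. if y \<le> x then f' y else k' y)" by simp
qed

text \<open>The derivative of \<open>vert\<close> carries a factor cos y, so at a zero of the cosine
  the curve touches height 1 with slope 0, like the horizontal line. The radicand equals 1 there, so
  it stays positive nearby and the square root is smooth.\<close>

lemma vert_glued: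
  assumes "cos x = 0"
  shows "C1_glued_at (vert \<delta>) (\<lambda>_. 1) x"
proof -
  have "\<forall>\<^sub>F y in nhds x. 0 < 1 - \<delta>\<^sup>2 * (cos y)\<^sup>2"
  proof -
    have "isCont (\<lambda>y. 1 - \<delta>\<^sup>2 * (cos y)\<^sup>2) x" by (intro continuous_intros)
    then have "((\<lambda>y. 1 - \<delta>\<^sup>2 * (cos y)\<^sup>2) \<longlongrightarrow> 1) (nhds x)"
      using assms by (simp add: continuous_at_imp_continuous_at_within tendsto_nhds_iff isCont_def)
    then show ?thesis by (rule order_tendstoD) simp
  qed
  then obtain \<epsilon> where \<epsilon>: "0 < \<epsilon>" "\<And>y. dist y x < \<epsilon> \<Longrightarrow> 0 < 1 - \<delta>\<^sup>2 * (cos y)\<^sup>2"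
    by (auto simp: eventually_nhds_metric)
  define I where "I = {x - \<epsilon><..<x + \<epsilon>}"
  define v' where "v' = (\<lambda>y. \<delta>\<^sup>2 * cos y * sin y / vert \<delta> y)"
  have pos: "0 < 1 - \<delta>\<^sup>2 * (cos y)\<^sup>2" if "y \<in> I" for y
    using that by (intro \<epsilon>) (auto simp: I_def dist_real_def abs_less_iff)
  have v: "(vert \<delta> has_real_derivative v' y) (at y)" if "y \<in> I" for y
    unfolding vert_def v'_def
    by (rule derivative_eq_intros refl | use pos[OF that] in force)+ (simp add: field_simps)
  have v'_cont: "continuous_on I v'"
    unfolding v'_def vert_def using pos by (intro continuous_intros) force
  have x: "x \<in> I" "vert \<delta> x = 1" "v' x = 0"
    using \<epsilon> assms by (auto simp: I_def vert_def v'_def)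
  have c: "((\<lambda>_. 1) has_real_derivative 0) (at y)" for y :: real by simp
  have "(\<lambda>y. if y \<le> x then vert \<delta> y else 1) C1_differentiable_on I"
    using x by (intro C1_differentiable_glue[where f' = v' and k' = "\<lambda>_. 0"] v v'_cont c) auto
  moreover have "(\<lambda>y. if y \<le> x then 1 else vert \<delta> y) C1_differentiable_on I"
    using x by (intro C1_differentiable_glue[where k' = v' and f' = "\<lambda>_. 0"] v v'_cont c) auto
  ultimately show ?thesis
    unfolding C1_glued_at_def using x \<epsilon>(1) by (auto simp: I_def)
qed

section \<open>Domain of the vertical branch\<close>

lemma fst_vertical:
  "fst ` vertical_curve \<delta> = {g. \<delta>\<^sup>2 * (cos g)\<^sup>2 \<le> 1}"
  "fst ` vertical_branch \<delta> = {g. \<delta>\<^sup>2 * (cos g)\<^sup>2 \<le> 1 \<and> 0 \<le> cos g}"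
  unfolding vertical_branch_def vertical_curve_def by (auto simp: image_iff Bex_def)

lemma fst_vertical_small:
  assumes "0 \<le> \<delta>" "\<delta> \<le> 1"
  shows "fst ` vertical_curve \<delta> = UNIV" "fst ` vertical_branch \<delta> = {g. 0 \<le> cos g}"
proof -
  have "\<delta>\<^sup>2 * (cos g)\<^sup>2 \<le> 1" for g
    using assms by (intro mult_le_one) (auto simp: power_le_one abs_square_le_1)
  then show "fst ` vertical_curve \<delta> = UNIV" "fst ` vertical_branch \<delta> = {g. 0 \<le> cos g}"
    unfolding fst_vertical by auto
qed

lemma square_mult_cos_le_1_iff:
  fixes \<delta> g :: real
  assumes "0 < \<delta>"
  shows "\<delta>\<^sup>2 * (cos g)\<^sup>2 \<le> 1 \<longleftrightarrow> \<bar>cos g\<bar> \<le> 1 / \<delta>"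
proof -
  have "\<delta>\<^sup>2 * (cos g)\<^sup>2 \<le> 1 \<longleftrightarrow> \<bar>\<delta> * cos g\<bar> \<le> 1"
    by (simp only: abs_square_le_1[symmetric] power_mult_distrib)
  then show ?thesis using assms by (simp add: abs_mult field_simps)
qed

lemma fst_vertical_large:
  assumes "1 < \<delta>"
  obtains a where "a \<in> {0<..<pi / 2}"
    "fst ` vertical_curve \<delta> \<inter> {-pi<..pi} = {a..pi - a} \<union> {-(pi - a)..-a}"
    "fst ` vertical_branch \<delta> \<inter> {-pi<..pi} = {a..pi / 2} \<union> {-(pi / 2)..-a}"
proof
  \<comment> \<open>The angle at which the radicand 1 - \<delta>^2 cos^2 g first vanishes; by
    symmetry it vanishes again at pi - a. Everything is then expressed through the absolute value of
    g, on which the cosine is decreasing.\<close>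
  define a where "a = arccos (1 / \<delta>)"
  have d: "0 < 1 / \<delta>" "1 / \<delta> < 1" using assms by auto
  have cos_a: "cos a = 1 / \<delta>" unfolding a_def using d by (intro cos_arccos) linarith+
  have "arccos 1 < a" "a < arccos 0"
    unfolding a_def using d by (intro arccos_less_arccos; linarith)+
  then have a: "0 < a" "a < pi / 2" by simp_all
  then show "a \<in> {0<..<pi / 2}" by simp
  have A: "cos g \<le> 1 / \<delta> \<longleftrightarrow> a \<le> \<bar>g\<bar>" "- (1 / \<delta>) \<le> cos g \<longleftrightarrow> \<bar>g\<bar> \<le> pi - a"
    "0 \<le> cos g \<longleftrightarrow> \<bar>g\<bar> \<le> pi / 2" if "\<bar>g\<bar> \<le> pi" for g
  proof -
    show "cos g \<le> 1 / \<delta> \<longleftrightarrow> a \<le> \<bar>g\<bar>"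
      using cos_mono_le_eq[of "\<bar>g\<bar>" a] that a by (simp add: cos_a)
    show "- (1 / \<delta>) \<le> cos g \<longleftrightarrow> \<bar>g\<bar> \<le> pi - a"
      using cos_mono_le_eq[of "pi - a" "\<bar>g\<bar>"] that a by (simp add: cos_a)
    show "0 \<le> cos g \<longleftrightarrow> \<bar>g\<bar> \<le> pi / 2"
      using cos_mono_le_eq[of "pi / 2" "\<bar>g\<bar>"] that by simp
  qed
  have le_pi: "\<bar>g\<bar> \<le> pi" if "g \<in> {-pi<..pi}" for g using that by auto
  have curve: "g \<in> fst ` vertical_curve \<delta> \<longleftrightarrow> a \<le> \<bar>g\<bar> \<and> \<bar>g\<bar> \<le> pi - a" if "\<bar>g\<bar> \<le> pi" for g
    using A[OF that] assms unfolding fst_vertical by (auto simp: square_mult_cos_le_1_iff abs_le_iff)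
  have branch: "g \<in> fst ` vertical_branch \<delta> \<longleftrightarrow> a \<le> \<bar>g\<bar> \<and> \<bar>g\<bar> \<le> pi - a \<and> \<bar>g\<bar> \<le> pi / 2"
    if "\<bar>g\<bar> \<le> pi" for g
    using curve[OF that] A(3)[OF that] unfolding fst_vertical by auto
  show "fst ` vertical_curve \<delta> \<inter> {-pi<..pi} = {a..pi - a} \<union> {-(pi - a)..-a}"
  proof (rule set_eqI)
    fix g
    show "g \<in> fst ` vertical_curve \<delta> \<inter> {-pi<..pi} \<longleftrightarrow> g \<in> {a..pi - a} \<union> {-(pi - a)..-a}"
      using curve[of g] le_pi[of g] a by (cases "g \<in> {-pi<..pi}") auto
  qed
  show "fst ` vertical_branch \<delta> \<inter> {-pi<..pi} = {a..pi / 2} \<union> {-(pi / 2)..-a}"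
  proof (rule set_eqI)
    fix g
    show "g \<in> fst ` vertical_branch \<delta> \<inter> {-pi<..pi} \<longleftrightarrow> g \<in> {a..pi / 2} \<union> {-(pi / 2)..-a}"
      using branch[of g] le_pi[of g] a by (cases "g \<in> {-pi<..pi}") auto
  qed
qed

text \<open>The witness is the point where the branch crosses G = 0, at cos g = 1 / \<delta>. It
  shows that the vertical part survives for large \<delta> and does not merely repeat boundary
  points of the horizontal lines.\<close>

lemma vertical_branch_meets_interior:
  assumes "1 \<le> \<delta>"
  shows "vertical_branch \<delta> \<inter> interior strip \<noteq> {}"
proof -
  have "cos (arccos (1 / \<delta>)) = 1 / \<delta>"
    using assms by (intro cos_arccos) (auto simp: field_simps intro: order.trans[of _ 0])
  then have "(arccos (1 / \<delta>), 0) \<in> vertical_branch \<delta>"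
    using assms by (simp add: vertical_branch_def vertical_curve_def vert_def power_divide)
  moreover have "(arccos (1 / \<delta>), 0) \<in> interior strip" by (simp add: interior_strip)
  ultimately show ?thesis by blast
qed

section \<open>Limit of the vertical branch for large \<delta>\<close>

lemma cos_eq_0_iff_sin: "cos g = 0 \<longleftrightarrow> sin g = 1 \<or> sin g = (-1::real)"
proof -
  have "cos g = 0 \<longleftrightarrow> (cos g)\<^sup>2 = 0" by simp
  also have "\<dots> \<longleftrightarrow> (sin g)\<^sup>2 = 1" by (auto simp: cos_squared_eq)
  finally show ?thesis by (simp add: power2_eq_1_iff)
qed

lemma mem_lift_vertical_lines:
  "(g, G) \<in> lift ({- pi / 2, pi / 2} \<times> {-1..1}) \<longleftrightarrow> cos g = 0 \<and> G \<in> {-1..1}"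
proof -
  have *: "(g, G) \<in> lift ({x} \<times> {-1..1}) \<longleftrightarrow> cos (g - x) = 1 \<and> G \<in> {-1..1}" for x
    unfolding mem_lift_iff cos_one_2pi_int by (auto simp: algebra_simps)
  have "{- pi / 2, pi / 2} \<times> {-1..1} = {- pi / 2} \<times> {-1..1} \<union> {pi / 2} \<times> {-1..1::real}" by auto
  then have "(g, G) \<in> lift ({- pi / 2, pi / 2} \<times> {-1..1}) \<longleftrightarrow>
      (cos (g - - pi / 2) = 1 \<or> cos (g - pi / 2) = 1) \<and> G \<in> {-1..1}"
    by (simp only: lift_Un Un_iff *) blast
  also have "\<dots> \<longleftrightarrow> (sin g = -1 \<or> sin g = 1) \<and> G \<in> {-1..1}"
    by (auto simp: cos_add cos_diff)
  finally show ?thesis unfolding cos_eq_0_iff_sin by blast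
qed

text \<open>The zeros of the cosine have spacing pi, so rounding leaves an offset of at most pi / 2.
  At a zero the sine is 1 or -1, and the addition formula turns a bound on cos g into a bound on the
  distance to the zero.\<close>

lemma nearest_zero_of_cos:
  obtains \<theta> where "\<bar>\<theta>\<bar> \<le> pi / 2" "cos (g - \<theta>) = 0" "\<bar>sin \<theta>\<bar> = \<bar>cos g\<bar>"
proof -
  define n where "n = round ((g - pi / 2) / pi)"
  define \<theta> where "\<theta> = g - (of_int n * pi + pi / 2)"
  have "\<bar>of_int n - (g - pi / 2) / pi\<bar> * pi \<le> 1 / 2 * pi"
    unfolding n_def by (intro mult_right_mono of_int_round_abs_le) auto
  also have "\<bar>of_int n - (g - pi / 2) / pi\<bar> * pi = \<bar>(of_int n - (g - pi / 2) / pi) * pi\<bar>"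
    by (simp add: abs_mult)
  also have "(of_int n - (g - pi / 2) / pi) * pi = - \<theta>"
    by (simp add: \<theta>_def field_simps)
  finally have "\<bar>\<theta>\<bar> \<le> pi / 2" by simp
  moreover have c0: "cos (g - \<theta>) = 0"
    unfolding cos_zero_iff_int2 \<theta>_def by (intro exI[of _ n]) simp
  moreover have "\<bar>sin \<theta>\<bar> = \<bar>cos g\<bar>"
  proof -
    have "cos g = cos (g - \<theta> + \<theta>)" by simp
    also have "\<dots> = - (sin (g - \<theta>) * sin \<theta>)" using c0 by (simp only: cos_add)
    finally show ?thesis
      using c0[unfolded cos_eq_0_iff_sin] by auto
  qed
  ultimately show thesis using that by blast
qed

text \<open>On the full curve the absolute value of cos g is at most 1 / \<delta>, so each of its
  points is within arcsin (1 / \<delta>) of a line. Conversely each point of a line is that close to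
  the branch. Hence any set between branch and curve converges, which settles both versions at
  once.\<close>

lemma vertical_hausdorff:
  fixes S :: "real \<Rightarrow> (real \<times> real) set"
  assumes "\<And>\<delta>. vertical_branch \<delta> \<subseteq> S \<delta>" "\<And>\<delta>. S \<delta> \<subseteq> vertical_curve \<delta>"
  shows "hausdorff_tendsto S (lift ({- pi / 2, pi / 2} \<times> {-1..1})) at_top"
  unfolding hausdorff_tendsto_def
proof (intro allI impI)
  fix \<epsilon> :: real assume "0 < \<epsilon>"
  \<comment> \<open>Capping at 1 keeps \<open>\<eta>\<close> below pi / 2, where the sine is
    increasing and a bound on it bounds the angle.\<close>
  define \<eta> where "\<eta> = min \<epsilon> 1"
  have \<eta>: "0 < \<eta>" "\<eta> \<le> \<epsilon>" "\<eta> < pi / 2" using \<open>0 < \<epsilon>\<close> pi_gt3 by (auto simp: \<eta>_def)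
  then have sin_\<eta>: "0 < sin \<eta>" by (intro sin_gt_zero) auto
  show "\<forall>\<^sub>F \<delta> in at_top.
      (\<forall>x\<in>S \<delta>. \<exists>y\<in>lift ({- pi / 2, pi / 2} \<times> {-1..1}). dist x y < \<epsilon>) \<and>
      (\<forall>y\<in>lift ({- pi / 2, pi / 2} \<times> {-1..1}). \<exists>x\<in>S \<delta>. dist x y < \<epsilon>)"
    using eventually_gt_at_top[of "max 1 (1 / sin \<eta>)"]
  proof eventually_elim
    case (elim \<delta>)
    then have \<delta>: "1 < \<delta>" "1 / sin \<eta> < \<delta>" by auto
    then have inv: "1 / \<delta> < sin \<eta>" using sin_\<eta> by (simp add: field_simps)
    have small: "\<bar>\<theta>\<bar> < \<epsilon>" if "\<bar>\<theta>\<bar> \<le> pi / 2" "\<bar>sin \<theta>\<bar> \<le> 1 / \<delta>" for \<theta> :: real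
    proof -
      have "\<bar>sin \<theta>\<bar> = sin \<bar>\<theta>\<bar>"
        using that(1) sin_ge_zero[of "\<bar>\<theta>\<bar>"] pi_gt_zero by (auto simp: abs_if split: if_splits)
      then have "sin \<bar>\<theta>\<bar> < sin \<eta>" using that inv by linarith
      then have "\<bar>\<theta>\<bar> < \<eta>" using that \<eta> by (subst (asm) sin_mono_less_eq) auto
      then show ?thesis using \<eta> by simp
    qed
    show ?case
    proof (intro conjI ballI)
      fix x assume "x \<in> S \<delta>"
      then have "x \<in> vertical_curve \<delta>" using assms(2) by blast
      then obtain g G where x: "x = (g, G)" "0 \<le> 1 - \<delta>\<^sup>2 * (cos g)\<^sup>2" "\<bar>G\<bar> = vert \<delta> g"
        by (auto simp: vertical_curve_def vert_def)
      have "\<bar>G\<bar> \<le> 1" using x by (simp add: vert_def)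
      have "\<bar>cos g\<bar> \<le> 1 / \<delta>" using x(2) \<delta> square_mult_cos_le_1_iff[of \<delta> g] by simp
      moreover obtain \<theta> where \<theta>: "\<bar>\<theta>\<bar> \<le> pi / 2" "cos (g - \<theta>) = 0" "\<bar>sin \<theta>\<bar> = \<bar>cos g\<bar>"
        by (rule nearest_zero_of_cos)
      ultimately have "\<bar>\<theta>\<bar> < \<epsilon>" using small by simp
      then have "dist x (g - \<theta>, G) < \<epsilon>" by (simp add: x dist_Pair_Pair dist_real_def)
      moreover have "(g - \<theta>, G) \<in> lift ({- pi / 2, pi / 2} \<times> {-1..1})"
        using \<theta> \<open>\<bar>G\<bar> \<le> 1\<close> by (auto simp only: mem_lift_vertical_lines abs_le_iff atLeastAtMost_iff)
      ultimately show "\<exists>y\<in>lift ({- pi / 2, pi / 2} \<times> {-1..1}). dist x y < \<epsilon>" by blast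
    next
      fix y :: "real \<times> real" assume "y \<in> lift ({- pi / 2, pi / 2} \<times> {-1..1})"
      then obtain g G where y: "y = (g, G)" "cos g = 0" "G \<in> {-1..1}"
        using mem_lift_vertical_lines by (metis surj_pair)
      define s where "s = sqrt (1 - G\<^sup>2)"
      have s: "0 \<le> s" "s \<le> 1" "s\<^sup>2 = 1 - G\<^sup>2" using sqrt_one_minus_sq[OF y(3)] by (simp_all add: s_def)
      \<comment> \<open>As cos g = 0, one has cos (g + \<theta>) = - sin g sin \<theta>. The sign -
        sin g makes this equal to s / \<delta> \<ge> 0, so the horizontal displacement lands on the
        branch and not on its reflected part.\<close>
      define \<theta> where "\<theta> = - sin g * arcsin (s / \<delta>)"
      have sd: "0 \<le> s / \<delta>" "s / \<delta> \<le> 1 / \<delta>" "s / \<delta> \<le> 1"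
        using s \<delta> by (auto simp: field_simps)
      have arc: "- (pi / 2) \<le> arcsin (s / \<delta>)" "arcsin (s / \<delta>) \<le> pi / 2" "sin (arcsin (s / \<delta>)) = s / \<delta>"
        using sd arcsin_bounded[of "s / \<delta>"] by auto
      have sg: "sin g = 1 \<or> sin g = -1" using y(2) by (simp add: cos_eq_0_iff_sin)
      then have "\<bar>\<theta>\<bar> \<le> pi / 2" "\<bar>sin \<theta>\<bar> \<le> 1 / \<delta>" "cos (g + \<theta>) = s / \<delta>"
        using arc sd y(2) by (auto simp: \<theta>_def cos_add cos_diff)
      then have "\<bar>\<theta>\<bar> < \<epsilon>" and c: "cos (g + \<theta>) = s / \<delta>" using small by auto
      then have "dist (g + \<theta>, G) y < \<epsilon>" by (simp add: y dist_Pair_Pair dist_real_def)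
      moreover have "1 - \<delta>\<^sup>2 * (cos (g + \<theta>))\<^sup>2 = G\<^sup>2" using c s \<delta> by (simp add: power_divide)
      then have "(g + \<theta>, G) \<in> vertical_branch \<delta>"
        using c sd by (intro mem_vertical_branchI) auto
      ultimately show "\<exists>x\<in>S \<delta>. dist x y < \<epsilon>" using assms(1) by blast
    qed
  qed
qed

section \<open>Extrema and degenerate cases\<close>

lemma F_P_minus: "F \<delta> P_minus = - \<delta>"
  using P_minus_in_level by (simp add: level_def)

lemma F_P_zero: "F \<delta> P_zero = \<delta>"
  using P_zero_in_level by (simp add: level_def)

lemma P_plus_in_level:
  assumes "0 < \<delta>" "\<delta> \<le> 2"
  shows "P_plus \<delta> \<in> level \<delta> (1 + \<delta>\<^sup>2 / 4)"
  using level_maximum[OF assms] mem_lift_self by blast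

lemma P_plus_large: "2 < \<delta> \<Longrightarrow> P_plus \<delta> = P_zero"
  by (simp add: P_plus_def P_zero_def)

lemma F_P_plus:
  assumes "0 < \<delta>" "\<delta> \<le> 2"
  shows "F \<delta> (P_plus \<delta>) = 1 + \<delta>\<^sup>2 / 4"
  using P_plus_in_level[OF assms] by (simp add: level_def)

lemma minimizers:
  assumes "0 < \<delta>"
  shows "{p. is_arg_min (F \<delta>) (\<lambda>p. p \<in> strip) p} = lift {P_minus}"
  unfolding level_minimum[OF assms, symmetric]
  using F_ge[OF assms] P_minus_in_level by (intro arg_min_eq_level) auto

lemma maximizers_small:
  assumes "0 < \<delta>" "\<delta> \<le> 2"
  shows "{p. is_arg_max (F \<delta>) (\<lambda>p. p \<in> strip) p} = lift {P_plus \<delta>, mirror (P_plus \<delta>)}"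
  unfolding level_maximum[OF assms, symmetric]
  using F_le[OF assms(1)] P_plus_in_level[OF assms] by (intro arg_max_eq_level) auto

lemma maximizers_large:
  assumes "2 < \<delta>"
  shows "{p. is_arg_max (F \<delta>) (\<lambda>p. p \<in> strip) p} = lift {P_plus \<delta>}"
proof -
  have "{p. is_arg_max (F \<delta>) (\<lambda>p. p \<in> strip) p} = level \<delta> \<delta>"
    using F_le_large assms P_zero_in_level[of \<delta>] by (intro arg_max_eq_level) auto
  then show ?thesis using level_maximum_large[OF assms] assms by (simp add: P_plus_def)
qed

lemma level_nonempty_small:
  assumes "0 < \<delta>" "\<delta> \<le> 2"
  shows "level \<delta> c \<noteq> {} \<longleftrightarrow> c \<in> {- \<delta>..1 + \<delta>\<^sup>2 / 4}"
  using F_ge F_le P_minus_in_level[of \<delta>] P_plus_in_level[OF assms] assms by (intro level_nonempty_iff) auto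

lemma level_nonempty_large:
  assumes "2 < \<delta>"
  shows "level \<delta> c \<noteq> {} \<longleftrightarrow> c \<in> {- \<delta>..\<delta>}"
  using F_ge F_le_large P_minus_in_level[of \<delta>] P_zero_in_level[of \<delta>] assms by (intro level_nonempty_iff) auto

lemma S0_eq_level: "S0 \<delta> = level \<delta> \<delta>"
  by (simp add: S0_def F_P_zero)

lemma level_delta_zero:
  "level 0 c = {(g, G). G \<in> {-1..1} \<and> G\<^sup>2 = c}"
  by (auto simp: level_def strip_def F_def)

lemma level_delta_zero_sqrt:
  assumes "c \<in> {0..1}"
  shows "level 0 c = UNIV \<times> {- sqrt c, sqrt c}"
proof -
  have "G \<in> {-1..1} \<and> G\<^sup>2 = c \<longleftrightarrow> G = - sqrt c \<or> G = sqrt c" for G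
  proof
    assume "G \<in> {-1..1} \<and> G\<^sup>2 = c"
    then have "sqrt c = \<bar>G\<bar>" by auto
    then show "G = - sqrt c \<or> G = sqrt c" by auto
  next
    have "sqrt c \<le> 1" "- 1 \<le> sqrt c" using assms order.trans[of "-1" 0 "sqrt c"] by auto
    moreover assume "G = - sqrt c \<or> G = sqrt c"
    ultimately show "G \<in> {-1..1} \<and> G\<^sup>2 = c" using assms by auto
  qed
  then show ?thesis unfolding level_delta_zero by auto
qed

lemma level_delta_zero_nonempty: "level 0 c \<noteq> {} \<longleftrightarrow> c \<in> {0..1}"
proof
  assume "level 0 c \<noteq> {}"
  then obtain G :: real where "G \<in> {-1..1}" "G\<^sup>2 = c" by (auto simp: level_delta_zero)
  then show "c \<in> {0..1}" using sqrt_one_minus_sq(3)[of G] zero_le_power2[of "sqrt (1 - G\<^sup>2)"] by auto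
qed (simp add: level_delta_zero_sqrt)

text \<open>At \<delta> = 2 the saddle value \<delta> and the maximum 1 + \<delta>^2 / 4 coincide,
  and the two mirror maxima merge at the origin.\<close>

lemma S0_two: "S0 2 = lift {P_zero}"
  using level_maximum[of 2] by (simp add: S0_eq_level P_plus_def mirror_def P_zero_def)

text \<open>The region \<open>F\<close> \<ge> \<delta> contains the saddle level and the librations
  enclosed by it, so this expresses that both collapse to the origin modulo 2 pi.\<close>

lemma superlevel_two: "{p \<in> strip. 2 \<le> F 2 p} = lift {P_zero}"
proof -
  have "{p \<in> strip. 2 \<le> F 2 p} = level 2 2"
    using F_le_large[of 2] unfolding level_def by force
  then show ?thesis using S0_two by (simp add: S0_eq_level)
qed

theorem mainTheorem2:
  shows
    "\<comment> \<open>equilibria\<close>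
     (\<forall>\<delta>\<in>{0<..<2}.
        {p. equilibrium (F \<delta>) p} = lift {P_minus, P_zero, P_plus \<delta>, mirror (P_plus \<delta>)} \<and>
        {p. is_arg_min (F \<delta>) (\<lambda>p. p \<in> strip) p} = lift {P_minus} \<and>
        {p. saddle (F \<delta>) p} = lift {P_zero} \<and>
        {p. is_arg_max (F \<delta>) (\<lambda>p. p \<in> strip) p} = lift {P_plus \<delta>, mirror (P_plus \<delta>)} \<and>
        F \<delta> P_minus = - \<delta> \<and> F \<delta> P_zero = \<delta> \<and> F \<delta> (P_plus \<delta>) = 1 + \<delta>\<^sup>2 / 4 \<and>
        (\<forall>c. level \<delta> c \<noteq> {} \<longleftrightarrow> c \<in> {-\<delta>..1 + \<delta>\<^sup>2 / 4})) \<and>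
     (\<forall>\<delta>>2.
        {p. equilibrium (F \<delta>) p} = lift {P_minus, P_plus \<delta>} \<and>
        {p. saddle (F \<delta>) p} = {} \<and>
        {p. is_arg_min (F \<delta>) (\<lambda>p. p \<in> strip) p} = lift {P_minus} \<and>
        P_plus \<delta> = (0, 0) \<and>
        {p. is_arg_max (F \<delta>) (\<lambda>p. p \<in> strip) p} = lift {P_plus \<delta>} \<and>
        (\<forall>c. level \<delta> c \<noteq> {} \<longleftrightarrow> c \<in> {-\<delta>..\<delta>})) \<and>

     \<comment> \<open>the manifolds S0 and S1\<close>
     (\<forall>\<delta>\<in>{0..2}. S0 \<delta> = {(g, G). -1 \<le> G \<and> G \<le> 1 \<and> G\<^sup>2 + \<delta> * sqrt (1 - G\<^sup>2) * cos g = \<delta>}) \<and>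
     (\<forall>\<delta>\<ge>0. S1 \<delta> = horizontal_branch \<union> vertical_branch \<delta>) \<and>
     (\<forall>\<delta>>0. vert \<delta> (pi / 2) = 1 \<and> C1_glued_at (vert \<delta>) (\<lambda>_. 1) (pi / 2) \<and>
             vert \<delta> (- pi / 2) = 1 \<and> C1_glued_at (vert \<delta>) (\<lambda>_. 1) (- pi / 2)) \<and>
     (\<forall>\<delta>\<in>{0..1}. fst ` vertical_curve \<delta> = UNIV \<and> fst ` vertical_branch \<delta> = {g. 0 \<le> cos g}) \<and>
     (\<forall>\<delta>>1. \<exists>a\<in>{0<..<pi / 2}.
        fst ` vertical_curve \<delta> \<inter> {-pi<..pi} = {a..pi - a} \<union> {-(pi - a)..-a} \<and>
        fst ` vertical_branch \<delta> \<inter> {-pi<..pi} = {a..pi / 2} \<union> {-(pi / 2)..-a}) \<and>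
     (\<forall>\<delta>>2. S1 \<delta> \<noteq> {} \<and> vertical_branch \<delta> \<inter> interior strip \<noteq> {}) \<and>
     hausdorff_tendsto vertical_curve (lift ({- pi / 2, pi / 2} \<times> {-1..1})) at_top \<and>
     hausdorff_tendsto vertical_branch (lift ({- pi / 2, pi / 2} \<times> {-1..1})) at_top \<and>

     \<comment> \<open>phase portrait, first case\<close>
     (\<forall>\<delta>\<in>{0<..1}.
        level \<delta> (-\<delta>) = lift {P_minus} \<and>
        (\<forall>c\<in>{-\<delta><..<\<delta>}. encircles (level \<delta> c) {P_minus}) \<and>
        level \<delta> \<delta> = S0 \<delta> \<and>
        (\<forall>c\<in>{\<delta><..<1}. defined_for_all_g (level \<delta> c)) \<and>
        level \<delta> 1 = S1 \<delta> \<and>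
        (\<forall>c\<in>{1<..<1 + \<delta>\<^sup>2 / 4}. encircles (level \<delta> c) {P_plus \<delta>, mirror (P_plus \<delta>)}) \<and>
        level \<delta> (1 + \<delta>\<^sup>2 / 4) = lift {P_plus \<delta>, mirror (P_plus \<delta>)}) \<and>
     (\<forall>\<delta>. \<delta> = 1 \<longrightarrow> S0 \<delta> = S1 \<delta> \<and> (\<forall>c\<in>{\<delta>..1}. level \<delta> c = S0 \<delta>)) \<and>
     (\<forall>\<delta>. \<delta> = 0 \<longrightarrow>
        (\<forall>c\<in>{-\<delta>..\<delta>}. level \<delta> c = S0 \<delta>) \<and>
        (\<forall>c\<in>{1..1 + \<delta>\<^sup>2 / 4}. level \<delta> c = S1 \<delta>) \<and>
        S0 \<delta> = UNIV \<times> {0} \<and>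
        S1 \<delta> = UNIV \<times> {-1, 1} \<and>
        (\<forall>c. level \<delta> c \<noteq> {} \<longleftrightarrow> c \<in> {0..1}) \<and>
        (\<forall>c\<in>{0..1}. level \<delta> c = UNIV \<times> {- sqrt c, sqrt c})) \<and>

     \<comment> \<open>phase portrait, second case\<close>
     (\<forall>\<delta>\<in>{1<..2}.
        level \<delta> (-\<delta>) = lift {P_minus} \<and>
        (\<forall>c\<in>{-\<delta><..<1}. encircles (level \<delta> c) {P_minus}) \<and>
        level \<delta> 1 = S1 \<delta> \<and>
        (\<forall>c\<in>{1<..<\<delta>}. encircles (level \<delta> c) {P_zero}) \<and>
        level \<delta> \<delta> = S0 \<delta> \<and>
        (\<forall>c\<in>{\<delta><..<1 + \<delta>\<^sup>2 / 4}. encircles (level \<delta> c) {P_plus \<delta>, mirror (P_plus \<delta>)}) \<and>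
        level \<delta> (1 + \<delta>\<^sup>2 / 4) = lift {P_plus \<delta>, mirror (P_plus \<delta>)}) \<and>
     (\<forall>\<delta>. \<delta> = 2 \<longrightarrow>
        (\<forall>c\<in>{\<delta>..1 + \<delta>\<^sup>2 / 4}. level \<delta> c = S0 \<delta>) \<and>
        S0 \<delta> = lift {P_zero} \<and>
        {p \<in> strip. \<delta> \<le> F \<delta> p} = lift {P_zero}) \<and>

     \<comment> \<open>phase portrait, third case\<close>
     (\<forall>\<delta>>2.
        level \<delta> (-\<delta>) = lift {P_minus} \<and>
        (\<forall>c\<in>{-\<delta><..<1}. encircles (level \<delta> c) {P_minus}) \<and>
        level \<delta> 1 = S1 \<delta> \<and>
        (\<forall>c\<in>{1<..<\<delta>}. encircles (level \<delta> c) {P_plus \<delta>}))"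
proof (intro conjI, goal_cases)
  case 1
  show ?case
    by (intro ballI conjI allI equilibria_small minimizers saddles_small maximizers_small
        F_P_minus F_P_zero F_P_plus level_nonempty_small) auto
next
  case 2
  show ?case
    by (intro allI impI conjI equilibria_large minimizers saddles_large maximizers_large
        level_nonempty_large) (auto simp: P_plus_def)
next
  case 3
  show ?case
    by (auto simp: S0_eq_level level_def strip_def F_def)
next
  case 4
  show ?case by (intro allI impI S1_eq)
next
  case 5
  show ?case by (intro allI impI conjI vert_glued) (simp_all add: vert_def)
next
  case 6
  show ?case by (intro ballI conjI fst_vertical_small) auto
next
  case 7
  show ?case by (meson fst_vertical_large)
next
  case 8
  show ?case
  proof (intro allI impI)
    fix \<delta> :: real assume "2 < \<delta>"
    then have "vertical_branch \<delta> \<inter> interior strip \<noteq> {}"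
      by (intro vertical_branch_meets_interior) simp
    then show "S1 \<delta> \<noteq> {} \<and> vertical_branch \<delta> \<inter> interior strip \<noteq> {}"
      using S1_eq[of \<delta>] \<open>2 < \<delta>\<close> by auto
  qed
next
  case 9
  show ?case by (intro vertical_hausdorff) (auto simp: vertical_branch_def)
next
  case 10
  show ?case by (intro vertical_hausdorff) (auto simp: vertical_branch_def)
next
  case 11
  show ?case
    by (intro ballI conjI level_minimum encircles_P_minus S0_eq_level[symmetric]
        level_defined_for_all_g S1_def[symmetric] encircles_P_plus level_maximum) auto
next
  case 12
  show ?case by (simp add: S0_eq_level S1_def)
next
  case 13
  show ?case
    using level_delta_zero_sqrt[of 0] level_delta_zero_sqrt[of 1] level_delta_zero_nonempty
    by (simp add: S0_eq_level S1_def level_delta_zero_sqrt)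
next
  case 14
  show ?case
    by (intro ballI conjI level_minimum encircles_P_minus S0_eq_level[symmetric]
        encircles_P_zero S1_def[symmetric] encircles_P_plus level_maximum) auto
next
  case 15
  show ?case using S0_two superlevel_two by (simp add: S0_eq_level)
next
  case 16
  \<comment> \<open>For \<delta> > 2 the maximum \<open>P_plus \<delta>\<close> is the origin, so
    the curves above c = 1 are those already obtained around \<open>P_zero\<close>.\<close>
  show ?case
    by (intro allI impI ballI conjI level_minimum encircles_P_minus S1_def[symmetric])
      (auto simp: P_plus_large intro: encircles_P_zero)
qed

end
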